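(* Let $n\ge 2$, let $f(x)=\sum_{i=0}^n a_ix^i$, and let $s_1,\ldots,s_{n-1}$ be the roots (with multiplicity) of $f'(x)$. Put \[A_{n,0}=\operatorname{disc}_x(f'),\qquad B_{n,0}=n^{n-2}a_n^{(n-2)(n-4)}\prod_{1\le i<j\le n-1}\frac{f(s_i)-f(s_j)}{(s_i-s_j)^3}.\] Then $A_{n,0}$ and $B_{n,0}$ are polynomials in $\mathbb{Q}[a_1,\ldots,a_n]$, and there is a nonzero rational constant $C_n$ depending only on $n$ such that \[DD_{n,0}=C_n\,A_{n,0}^3\,B_{n,0}^2\quad\text{in }\mathbb{Q}[a_1,\ldots,a_n].\]
   Context: Here $a_0,\ldots,a_n$ are independent indeterminates and $s_1,\ldots,s_{n-1}$ lie in an algebraic closure of $\mathbb{Q}(a_0,\ldots,a_n)$. Discriminants are normalized so that for a polynomial $g$ of degree $d$ with leading coefficient $c$ and roots $\rho_1,\ldots,\rho_d$, $\operatorname{disc} g=c^{2d-2}\prod_{i<j}(\rho_i-\rho_j)^2$ (so $\operatorname{disc}_x(f')=(na_n)^{2(n-2)}\prod_{i<j}(s_i-s_j)^2$). $D_n=\operatorname{disc}_x f\in\mathbb{Z}[a_0,\ldots,a_n]$, and $DD_{n,0}=\operatorname{disc}_{a_0}(D_n)\in\mathbb{Z}[a_1,\ldots,a_n]$ is the discriminant of $D_n$ regarded as a polynomial in $a_0$ (of degree $n-1$). *)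

theory Defs
  imports "HOL-Library.Poly_Mapping" "HOL-Algebra.Algebraic_Closure_Type"
begin

text \<open>
  Polynomials with rational coefficients in indeterminates \<open>a\<^sub>0, a\<^sub>1, \<dots>\<close>: finitely supported maps
  from monomials (finitely supported exponent vectors) to coefficients, under convolution.
\<close>

type_synonym qpoly = "(nat \<Rightarrow>\<^sub>0 nat) \<Rightarrow>\<^sub>0 rat"

definition indet :: "nat \<Rightarrow> qpoly" where
  "indet i = Poly_Mapping.single (Poly_Mapping.single i 1) 1"

definition qconst :: "rat \<Rightarrow> qpoly" where
  "qconst c = Poly_Mapping.single 0 c"

text \<open>The subring \<open>\<rat>[a\<^sub>i | i \<in> I]\<close>.\<close>

definition qpolys_in :: "nat set \<Rightarrow> qpoly set" where
  "qpolys_in I = {p. \<forall>m \<in> Poly_Mapping.keys p. Poly_Mapping.keys m \<subseteq> I}"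

text \<open>
  An algebraic closure of \<open>\<rat>(a\<^sub>0, a\<^sub>1, \<dots>)\<close>. For every \<open>n\<close> it contains an algebraic closure of
  \<open>\<rat>(a\<^sub>0, \<dots>, a\<^sub>n)\<close>, and all roots considered below lie in the latter.
\<close>

type_synonym qclosure = "qpoly fract alg_closure"

definition emb :: "qpoly \<Rightarrow> qclosure" where
  "emb p = to_ac (Fract p 1)"

text \<open>
  \<open>\<rho> 1, \<dots>, \<rho> d\<close> is an enumeration, with multiplicity, of the roots of \<open>g\<close>, where \<open>d\<close> is the
  degree of \<open>g\<close>.
\<close>

definition enumerates_roots :: "(nat \<Rightarrow> 'a) \<Rightarrow> 'a :: alg_closed_field poly \<Rightarrow> bool" where
  "enumerates_roots \<rho> g \<longleftrightarrow>
     image_mset \<rho> (mset_set {1..Polynomial.degree g}) = proots g"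

text \<open>
  The discriminant does not depend on the chosen enumeration of the roots, as the product is
  symmetric in them. For \<open>degree g \<ge> 1\<close> the exponent \<open>2 * degree g - 2\<close> is not truncated.
\<close>

definition disc :: "'a :: alg_closed_field poly \<Rightarrow> 'a" where
  "disc g =
     (let d = Polynomial.degree g; \<rho> = (SOME \<rho>. enumerates_roots \<rho> g)
      in Polynomial.lead_coeff g ^ (2 * d - 2) * (\<Prod>j\<in>{1..d}. \<Prod>i\<in>{1..<j}. (\<rho> i - \<rho> j)\<^sup>2))"

definition gen_poly :: "nat \<Rightarrow> qclosure poly" where
  "gen_poly n = (\<Sum>i\<le>n. Polynomial.monom (emb (indet i)) i)"

text \<open>
  \<open>D\<close> is the discriminant \<open>D\<^sub>n\<close> of \<open>gen_poly n\<close> regarded as a univariate polynomial in \<open>a\<^sub>0\<close> over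
  \<open>\<rat>[a\<^sub>1, \<dots>, a\<^sub>n]\<close>. It is unique, because \<open>a\<^sub>0\<close> is transcendental over \<open>\<rat>(a\<^sub>1, \<dots>, a\<^sub>n)\<close>.
\<close>

definition is_disc_in_a0 :: "nat \<Rightarrow> qpoly poly \<Rightarrow> bool" where
  "is_disc_in_a0 n D \<longleftrightarrow>
     (\<forall>k. poly.coeff D k \<in> qpolys_in {1..n}) \<and> emb (poly D (indet 0)) = disc (gen_poly n)"

definition A0 :: "nat \<Rightarrow> qclosure" where
  "A0 n = disc (pderiv (gen_poly n))"

text \<open>
  The exponent \<open>(n - 2) (n - 4)\<close> of \<open>a\<^sub>n\<close> is negative for \<open>n = 3\<close>, hence the integer power.
\<close>

definition B0 :: "nat \<Rightarrow> (nat \<Rightarrow> qclosure) \<Rightarrow> qclosure" where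
  "B0 n s =
     of_nat n ^ (n - 2) * emb (indet n) powi ((int n - 2) * (int n - 4)) *
     (\<Prod>j\<in>{1..n-1}. \<Prod>i\<in>{1..<j}.
        (poly (gen_poly n) (s i) - poly (gen_poly n) (s j)) / (s i - s j) ^ 3)"

end

theory Submission
  imports Defs "HOL-Combinatorics.Permutations"
begin

text \<open>
  Put \<open>m = n - 1\<close> and \<open>c = n a\<^sub>n\<close>, the leading coefficient of \<open>f'\<close>. Up to sign,
  \<open>D\<^sub>n = n c\<^sup>m \<Prod> f(s\<^sub>j)\<close>. Since \<open>f = a\<^sub>0 + \<phi> + x f' / n\<close> with \<open>\<phi>\<close> of degree at most \<open>m\<close> and free of
  \<open>a\<^sub>0\<close>, the roots of \<open>D\<^sub>n\<close> as a polynomial in \<open>a\<^sub>0\<close> are the \<open>- \<phi>(s\<^sub>j)\<close>, whose differences are the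
  \<open>f(s\<^sub>i) - f(s\<^sub>j)\<close> up to sign. The factorization of \<open>DD\<close> is then a comparison of powers of \<open>n\<close> and
  \<open>a\<^sub>n\<close>.

  That all quantities are polynomials in the \<open>a\<^sub>i\<close> rests on one fact: if \<open>F\<close> is a symmetric
  polynomial of degree at most \<open>d\<close> in each variable, then \<open>c\<^sup>d F(s)\<close> is a polynomial in the
  coefficients of \<open>c \<Prod> (x - s\<^sub>j)\<close>. For \<open>B\<close>, the quotient \<open>(f(s\<^sub>i) - f(s\<^sub>j)) / (s\<^sub>i - s\<^sub>j)\<^sup>3\<close> is written
  as a polynomial in the roots by integrating \<open>f'\<close> along the segment from \<open>s\<^sub>j\<close> to \<open>s\<^sub>i\<close>.
\<close>

subsection \<open>Subrings containing the rationals\<close>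

text \<open>Divisibility by positive integers is phrased as cancellation of \<open>of_nat k\<close>,
  so the ambient ring need not have inverses: it will also be a polynomial ring. In a field of
  characteristic 0 these are the subrings that contain the rationals.\<close>

definition rational_subalgebra :: "'a::comm_ring_1 set \<Rightarrow> bool" where
  "rational_subalgebra R \<longleftrightarrow>
     1 \<in> R \<and> (\<forall>x\<in>R. -x \<in> R) \<and> (\<forall>x\<in>R. \<forall>y\<in>R. x + y \<in> R \<and> x * y \<in> R) \<and>
     (\<forall>k x. k > 0 \<longrightarrow> of_nat k * x \<in> R \<longrightarrow> x \<in> R)"

lemma subalgebra_1: "rational_subalgebra R \<Longrightarrow> 1 \<in> R"
  unfolding rational_subalgebra_def by blast

lemma subalgebra_uminus: "rational_subalgebra R \<Longrightarrow> x \<in> R \<Longrightarrow> -x \<in> R"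
  unfolding rational_subalgebra_def by blast

lemma subalgebra_add: "rational_subalgebra R \<Longrightarrow> x \<in> R \<Longrightarrow> y \<in> R \<Longrightarrow> x + y \<in> R"
  unfolding rational_subalgebra_def by blast

lemma subalgebra_mult: "rational_subalgebra R \<Longrightarrow> x \<in> R \<Longrightarrow> y \<in> R \<Longrightarrow> x * y \<in> R"
  unfolding rational_subalgebra_def by blast

lemma subalgebra_of_nat_mult_cancel:
  "rational_subalgebra R \<Longrightarrow> k > 0 \<Longrightarrow> of_nat k * x \<in> R \<Longrightarrow> x \<in> R"
  unfolding rational_subalgebra_def by blast

lemma subalgebra_diff: "rational_subalgebra R \<Longrightarrow> x \<in> R \<Longrightarrow> y \<in> R \<Longrightarrow> x - y \<in> R"
  using subalgebra_add[of R x "-y"] subalgebra_uminus[of R y] by simp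

lemma subalgebra_0: "rational_subalgebra R \<Longrightarrow> 0 \<in> R"
  using subalgebra_diff[of R 1 1] subalgebra_1[of R] by simp

lemma subalgebra_sum: "rational_subalgebra R \<Longrightarrow> (\<And>i. i \<in> A \<Longrightarrow> f i \<in> R) \<Longrightarrow> sum f A \<in> R"
  by (induction A rule: infinite_finite_induct) (simp_all add: subalgebra_0 subalgebra_add)

lemma subalgebra_power: "rational_subalgebra R \<Longrightarrow> x \<in> R \<Longrightarrow> x ^ k \<in> R"
  by (induction k) (simp_all add: subalgebra_1 subalgebra_mult)

lemma subalgebra_of_nat: "rational_subalgebra R \<Longrightarrow> of_nat k \<in> R"
  by (induction k) (simp_all add: subalgebra_0 subalgebra_1 subalgebra_add)

text \<open>Lets the theorem on symmetric polynomials handle all coefficients of a product of linear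
  polynomials at once, with polynomials as values.\<close>

lemma rational_subalgebra_poly:
  assumes "rational_subalgebra R"
  shows "rational_subalgebra {p. \<forall>k. poly.coeff p k \<in> R}"
  unfolding rational_subalgebra_def
proof (safe, goal_cases)
  case (1 k)
  show ?case by (auto simp: coeff_1 subalgebra_0[OF assms] subalgebra_1[OF assms])
next
  case (2 p k)
  then show ?case by (auto intro: subalgebra_uminus[OF assms])
next
  case (3 p q k)
  then show ?case by (auto intro: subalgebra_add[OF assms])
next
  case (4 p q k)
  then show ?case
    by (auto simp: coeff_mult intro!: subalgebra_sum[OF assms] subalgebra_mult[OF assms])
next
  case (5 k p j)
  have "of_nat k * poly.coeff p j \<in> R"
    using 5(2)[rule_format, of j] by (simp add: of_nat_poly)
  then show ?case using subalgebra_of_nat_mult_cancel[OF assms 5(1)] by blast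
qed

subsection \<open>The embedding into the closure\<close>

lemma emb_add [simp]: "emb (p + q) = emb p + emb q"
  unfolding emb_def to_ac_add[symmetric] by simp

lemma emb_uminus [simp]: "emb (-p) = -emb p"
  by (simp only: emb_def to_ac_minus[symmetric] minus_fract)

lemma emb_mult [simp]: "emb (p * q) = emb p * emb q"
  by (simp only: emb_def to_ac_mult[symmetric] mult_fract mult_1)

lemma emb_0 [simp]: "emb 0 = 0"
  by (simp add: emb_def flip: Zero_fract_def)

lemma emb_1 [simp]: "emb 1 = 1"
  by (simp add: emb_def flip: One_fract_def)

lemma emb_eq_iff [simp]: "emb p = emb q \<longleftrightarrow> p = q"
  by (simp add: emb_def eq_fract)

lemma emb_power [simp]: "emb (p ^ k) = emb p ^ k"
  by (induction k) auto

lemma emb_of_nat [simp]: "emb (of_nat k) = of_nat k"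
  by (induction k) auto

lemma qconst_mult: "qconst (a * b) = qconst a * qconst b"
  by (simp add: qconst_def mult_single)

lemma qconst_of_nat: "qconst (of_nat k) = of_nat k"
  by (simp only: qconst_def single_of_nat)

lemma emb_qconst_power: "emb (qconst (a ^ k)) = emb (qconst a) ^ k"
proof (induction k)
  case 0
  show ?case using qconst_of_nat[of 1] by simp
qed (simp add: qconst_mult)

lemma emb_qconst_inverse: "emb (qconst (inverse a)) = inverse (emb (qconst a))"
proof (cases "a = 0")
  case True
  then show ?thesis using qconst_of_nat[of 0] by simp
next
  case False
  then have "emb (qconst a) * emb (qconst (inverse a)) = 1"
    using qconst_of_nat[of 1] by (simp flip: emb_mult qconst_mult)
  then show ?thesis by (rule inverse_unique[symmetric])
qed

text \<open>The constant of the factorization is a power of \<open>n\<close> whose exponent is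
  negative for \<open>n = 3\<close>, hence the integer power.\<close>

lemma emb_qconst_power_int: "emb (qconst (a powi k)) = emb (qconst a) powi k"
  by (simp add: power_int_def emb_qconst_power emb_qconst_inverse)

lemma CHAR_qclosure: "CHAR(qclosure) = 0"
proof -
  have "(of_nat k :: qclosure) \<noteq> 0" if "k > 0" for k
    using that emb_eq_iff[of "of_nat k" 0] by simp
  then show ?thesis unfolding CHAR_eq0_iff by blast
qed

lemma qpolys_in_add: "p \<in> qpolys_in I \<Longrightarrow> q \<in> qpolys_in I \<Longrightarrow> p + q \<in> qpolys_in I"
  using Poly_Mapping.keys_add[of p q] by (auto simp: qpolys_in_def)

lemma qpolys_in_mult:
  assumes "p \<in> qpolys_in I" "q \<in> qpolys_in I"
  shows "p * q \<in> qpolys_in I"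
  unfolding qpolys_in_def
proof (rule CollectI, rule ballI)
  fix k assume "k \<in> Poly_Mapping.keys (p * q)"
  then obtain a b where "k = a + b" "a \<in> Poly_Mapping.keys p" "b \<in> Poly_Mapping.keys q"
    using keys_mult[of p q] by blast
  then show "Poly_Mapping.keys k \<subseteq> I"
    using assms Poly_Mapping.keys_add[of a b] by (fastforce simp: qpolys_in_def)
qed

lemma qconst_in_qpolys_in: "qconst a \<in> qpolys_in I"
  by (simp add: qpolys_in_def qconst_def)

lemma indet_in_qpolys_in: "i \<in> I \<Longrightarrow> indet i \<in> qpolys_in I"
  by (simp add: qpolys_in_def indet_def)

lemma rational_subalgebra_emb_qpolys_in: "rational_subalgebra (emb ` qpolys_in I)"
  unfolding rational_subalgebra_def
proof (intro conjI ballI allI impI)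
  show "1 \<in> emb ` qpolys_in I" using imageI[OF qconst_in_qpolys_in, of emb 1 I] qconst_of_nat[of 1] by simp
next
  fix x assume "x \<in> emb ` qpolys_in I"
  then show "-x \<in> emb ` qpolys_in I"
    by (auto simp: qpolys_in_def simp flip: emb_uminus)
next
  fix x y assume "x \<in> emb ` qpolys_in I" "y \<in> emb ` qpolys_in I"
  then show "x + y \<in> emb ` qpolys_in I" "x * y \<in> emb ` qpolys_in I"
    by (auto simp: qpolys_in_add qpolys_in_mult simp flip: emb_add emb_mult)
next
  fix k :: nat and x assume k: "k > 0" "of_nat k * x \<in> emb ` qpolys_in I"
  then obtain p where p: "p \<in> qpolys_in I" "of_nat k * x = emb p" by auto
  have "emb (qconst (1 / of_nat k)) * of_nat k = emb (qconst (1 / of_nat k) * qconst (of_nat k))"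
    by (simp add: qconst_of_nat)
  also have "\<dots> = 1" using k(1) qconst_of_nat[of 1] by (simp flip: qconst_mult)
  finally have "x = emb (qconst (1 / of_nat k)) * (of_nat k * x)" by (simp flip: mult.assoc)
  also have "\<dots> = emb (qconst (1 / of_nat k) * p)" by (simp add: p(2))
  finally show "x \<in> emb ` qpolys_in I"
    using p(1) qpolys_in_mult qconst_in_qpolys_in by blast
qed

lemma poly_emb_preimage:
  assumes "\<And>k. poly.coeff P k \<in> emb ` qpolys_in I"
  shows "\<exists>D. (\<forall>k. poly.coeff D k \<in> qpolys_in I) \<and> map_poly emb D = P"
proof -
  define g where "g = inv_into (qpolys_in I) emb"
  have g: "g (poly.coeff P k) \<in> qpolys_in I" "emb (g (poly.coeff P k)) = poly.coeff P k" for k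
    unfolding g_def using assms[of k] by (auto intro: inv_into_into f_inv_into_f)
  \<comment> \<open>\<open>map_poly g\<close> acts coefficientwise only if \<open>g 0 = 0\<close>. A
    coefficient beyond the degree gives \<open>emb (g 0) = 0\<close>, and \<open>emb\<close> is
    injective.\<close>
  have "emb (g 0) = 0"
    using g(2)[of "Suc (Polynomial.degree P)"] by (simp add: coeff_eq_0)
  then have "g 0 = 0" using emb_eq_iff[of "g 0" 0] by simp
  then show ?thesis using g
    by (intro exI[of _ "map_poly g P"]) (auto intro!: poly_eqI simp: coeff_map_poly)
qed

lemma poly_map_poly_emb: "poly (map_poly emb D) (emb x) = emb (poly D x)"
  by (induction D) (auto simp: map_poly_pCons)

lemma coeff_gen_poly: "poly.coeff (gen_poly n) k = (if k \<le> n then emb (indet k) else 0)"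
  by (simp add: gen_poly_def coeff_sum)

lemma emb_indet_nonzero: "emb (indet i) \<noteq> 0"
proof -
  have "indet i \<noteq> 0"
  proof
    assume "indet i = 0"
    then have "Poly_Mapping.lookup (indet i) (Poly_Mapping.single i 1) = 0" by simp
    then show False by (simp add: indet_def)
  qed
  then show ?thesis using emb_eq_iff[of _ 0] by simp
qed

lemma degree_gen_poly: "Polynomial.degree (gen_poly n) = n"
  by (rule antisym[OF degree_le le_degree]) (auto simp: coeff_gen_poly emb_indet_nonzero)

subsection \<open>Symmetric polynomials at the roots of a polynomial\<close>

definition esym :: "'i set \<Rightarrow> ('i \<Rightarrow> 'a::comm_ring_1) \<Rightarrow> nat \<Rightarrow> 'a" where
  "esym I s k = (\<Sum>S | S \<subseteq> I \<and> card S = k. \<Prod>i\<in>S. s i)"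

text \<open>For finite \<open>I\<close>, this is the monomial symmetric polynomial with exponents
  \<open>e\<close>, multiplied by the order of the stabilizer of \<open>e\<close>. The multiplicity
  is harmless because positive integers can be cancelled.\<close>

definition perm_sum :: "'i set \<Rightarrow> ('i \<Rightarrow> 'a::comm_ring_1) \<Rightarrow> ('i \<Rightarrow> nat) \<Rightarrow> 'a" where
  "perm_sum I s e = (\<Sum>\<sigma> | \<sigma> permutes I. \<Prod>i\<in>I. s (\<sigma> i) ^ e i)"

lemma esym_permute:
  assumes "\<sigma> permutes I"
  shows "esym I (s \<circ> \<sigma>) k = esym I s k"
proof -
  have inj: "inj_on ((`) \<sigma>) Z" for Z
    using permutes_inj[OF assms] by (auto intro: inj_onI simp: inj_image_eq_iff)
  have "bij_betw ((`) \<sigma>) {S. S \<subseteq> I \<and> card S = k} {S. S \<subseteq> I \<and> card S = k}"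
    unfolding bij_betw_def
  proof (intro conjI inj subset_antisym subsetI)
    fix S assume "S \<in> (`) \<sigma> ` {S. S \<subseteq> I \<and> card S = k}"
    then show "S \<in> {S. S \<subseteq> I \<and> card S = k}"
      using permutes_image[OF assms] permutes_inj[OF assms]
      by (auto simp: card_image inj_on_subset)
  next
    fix S assume S: "S \<in> {S. S \<subseteq> I \<and> card S = k}"
    have "S = \<sigma> ` (inv_into UNIV \<sigma> ` S)"
      by (simp add: image_image permutes_inverses(1)[OF assms])
    moreover have "inv_into UNIV \<sigma> ` S \<subseteq> I"
      using S permutes_image[OF permutes_inv[OF assms]] by blast
    moreover have "card (inv_into UNIV \<sigma> ` S) = k"
      using S permutes_inj[OF permutes_inv[OF assms]] by (simp add: card_image inj_on_subset)
    ultimately show "S \<in> (`) \<sigma> ` {S. S \<subseteq> I \<and> card S = k}" by blast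
  qed
  from sum.reindex_bij_betw[OF this, of "\<lambda>S. \<Prod>i\<in>S. s i"]
  have "esym I s k = (\<Sum>S | S \<subseteq> I \<and> card S = k. \<Prod>i\<in>\<sigma> ` S. s i)"
    by (simp add: esym_def)
  also have "\<dots> = esym I (s \<circ> \<sigma>) k"
    unfolding esym_def
    by (intro sum.cong refl)
       (simp add: prod.reindex inj_on_subset[OF permutes_inj[OF assms]])
  finally show ?thesis by simp
qed

text \<open>By invariance the elementary symmetric factor may be expanded in the permuted variables
  of each summand; the term of \<open>S\<close> then raises the exponents on \<open>S\<close> by
  one.\<close>

lemma esym_times_perm_sum:
  assumes "finite I"
  shows "esym I s k * perm_sum I s e =
    (\<Sum>S | S \<subseteq> I \<and> card S = k. perm_sum I s (\<lambda>i. e i + (if i \<in> S then 1 else 0)))"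
proof -
  have "esym I s k * perm_sum I s e =
      (\<Sum>\<sigma> | \<sigma> permutes I. esym I (s \<circ> \<sigma>) k * (\<Prod>i\<in>I. s (\<sigma> i) ^ e i))"
    unfolding perm_sum_def sum_distrib_left
    by (intro sum.cong refl) (simp add: esym_permute)
  also have "\<dots> = (\<Sum>\<sigma> | \<sigma> permutes I. \<Sum>S | S \<subseteq> I \<and> card S = k.
      \<Prod>i\<in>I. s (\<sigma> i) ^ (e i + (if i \<in> S then 1 else 0)))"
    unfolding esym_def sum_distrib_right
  proof (intro sum.cong refl)
    fix \<sigma> S assume "S \<in> {S. S \<subseteq> I \<and> card S = k}"
    then have S: "S \<subseteq> I" by simp
    have "(\<Prod>i\<in>I. s (\<sigma> i) ^ (e i + (if i \<in> S then 1 else 0))) =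
        (\<Prod>i\<in>I. s (\<sigma> i) ^ e i) * (\<Prod>i\<in>I. if i \<in> S then s (\<sigma> i) else 1)"
      unfolding prod.distrib[symmetric] by (intro prod.cong) auto
    also have "(\<Prod>i\<in>I. if i \<in> S then s (\<sigma> i) else 1) = (\<Prod>i\<in>S. s (\<sigma> i))"
      using S assms by (simp add: prod.If_cases Int_absorb1)
    finally show "(\<Prod>i\<in>S. (s \<circ> \<sigma>) i) * (\<Prod>i\<in>I. s (\<sigma> i) ^ e i) =
        (\<Prod>i\<in>I. s (\<sigma> i) ^ (e i + (if i \<in> S then 1 else 0)))"
      by (simp add: mult.commute)
  qed
  also have "\<dots> = (\<Sum>S | S \<subseteq> I \<and> card S = k. perm_sum I s (\<lambda>i. e i + (if i \<in> S then 1 else 0)))"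
    unfolding perm_sum_def by (rule sum.swap)
  finally show ?thesis .
qed

text \<open>Exponents with the same multiset of values differ by a permutation of \<open>I\<close>,
  and composing with it only reorders the sum over all permutations.\<close>

lemma perm_sum_cong:
  assumes "finite I" "image_mset e (mset_set I) = image_mset e' (mset_set I)"
  shows "perm_sum I s e = perm_sum I s e'"
proof -
  obtain \<pi> where \<pi>: "\<pi> permutes I" "\<forall>x\<in>I. e x = e' (\<pi> x)"
    using image_mset_eq_implies_permutes[OF assms] by blast
  have "perm_sum I s e = (\<Sum>\<sigma> | \<sigma> permutes I. \<Prod>i\<in>I. s ((\<sigma> \<circ> \<pi>) i) ^ e i)"
    unfolding perm_sum_def
    by (rule sum_permutations_compose_right[OF \<pi>(1)])
  also have "\<dots> = perm_sum I s e'"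
    unfolding perm_sum_def
  proof (intro sum.cong refl)
    fix \<sigma> assume "\<sigma> \<in> {\<sigma>. \<sigma> permutes I}"
    have "(\<Prod>i\<in>I. s (\<sigma> i) ^ e' i) = (\<Prod>i\<in>I. s (\<sigma> (\<pi> i)) ^ e' (\<pi> i))"
      by (rule prod.permute[OF \<pi>(1), unfolded o_def])
    then show "(\<Prod>i\<in>I. s ((\<sigma> \<circ> \<pi>) i) ^ e i) = (\<Prod>i\<in>I. s (\<sigma> i) ^ e' i)"
      using \<pi>(2) by simp
  qed
  finally show ?thesis .
qed

text \<open>If \<open>S\<close> contains the support \<open>U\<close> of \<open>u\<close>, the new
  exponents are those of \<open>U\<close> raised by one, then \<open>card S - card U\<close> ones,
  then zeros. Only the size of \<open>S\<close> enters.\<close>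

lemma image_mset_add_indicator:
  fixes u :: "'i \<Rightarrow> nat"
  assumes "finite I" "S \<subseteq> I" "T \<subseteq> I" "card S = card T"
    "\<And>i. i \<in> I \<Longrightarrow> u i > 0 \<Longrightarrow> i \<in> S \<inter> T"
  shows "image_mset (\<lambda>i. u i + (if i \<in> S then 1 else 0)) (mset_set I) =
         image_mset (\<lambda>i. u i + (if i \<in> T then 1 else 0)) (mset_set I)"
proof -
  define U where "U = {i\<in>I. u i > 0}"
  have *: "image_mset (\<lambda>i. u i + (if i \<in> S then 1 else 0)) (mset_set I) =
      image_mset (\<lambda>i. u i + 1) (mset_set U) + replicate_mset (card S - card U) 1
      + replicate_mset (card I - card S) 0"
    if S: "S \<subseteq> I" "\<And>i. i \<in> I \<Longrightarrow> u i > 0 \<Longrightarrow> i \<in> S" for S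
  proof -
    have US: "U \<subseteq> S" "U \<subseteq> I" using S by (auto simp: U_def)
    have fin: "finite S" "finite U" using assms(1) S(1) US finite_subset by blast+
    have "S = U \<union> (S - U)" "I = S \<union> (I - S)" using US S(1) by auto
    then have "mset_set S = mset_set U + mset_set (S - U)" "mset_set I = mset_set S + mset_set (I - S)"
      using mset_set_Union[of U "S - U"] mset_set_Union[of S "I - S"] fin assms(1) by simp_all
    then have split: "mset_set I = mset_set U + mset_set (S - U) + mset_set (I - S)"
      by simp
    have 1: "image_mset (\<lambda>i. u i + (if i \<in> S then 1 else 0)) (mset_set U) =
        image_mset (\<lambda>i. u i + 1) (mset_set U)"
      using US fin by (intro image_mset_cong) auto
    have 2: "image_mset (\<lambda>i. u i + (if i \<in> S then 1 else 0)) (mset_set (S - U)) =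
        image_mset (\<lambda>_. 1) (mset_set (S - U))"
      using S(1) fin by (intro image_mset_cong) (auto simp: U_def)
    have 3: "image_mset (\<lambda>i. u i + (if i \<in> S then 1 else 0)) (mset_set (I - S)) =
        image_mset (\<lambda>_. 0) (mset_set (I - S))"
      using US assms(1) by (intro image_mset_cong) (auto simp: U_def)
    show ?thesis
      unfolding split image_mset_union 1 2 3
      using US S(1) fin assms(1) by (simp add: image_mset_const_eq card_Diff_subset)
  qed
  show ?thesis
    using *[of S] *[of T] assms(2-5) by simp
qed

text \<open>
  Write \<open>k\<close> for the size of the support of \<open>e\<close>. Multiplying the \<open>k\<close>-th elementary symmetric
  polynomial by the orbit sum of \<open>e\<close> with all positive exponents lowered by one gives a
  positive multiple of the orbit sum of \<open>e\<close>, plus orbit sums with larger support.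
\<close>

lemma perm_sum_in_subalgebra:
  fixes s :: "'i \<Rightarrow> 'a::comm_ring_1"
  assumes R: "rational_subalgebra R" and I: "finite I"
    and esym: "\<And>k. k \<le> card I \<Longrightarrow> c * esym I s k \<in> R"
    and "\<And>i. i \<in> I \<Longrightarrow> e i \<le> d"
  shows "c ^ d * perm_sum I s e \<in> R"
  using assms(4)
proof (induction d arbitrary: e)
  case 0
  then show ?case
    by (simp add: perm_sum_def subalgebra_of_nat[OF R])
next
  case (Suc d)
  \<comment> \<open>For a fixed degree bound, the induction is on the number of zero exponents: the
    unwanted orbit sums have larger support.\<close>
  show ?case using Suc.prems
  proof (induction "card I - card {i\<in>I. e i > 0}" arbitrary: e rule: less_induct)
    case less
    define T where "T = {i\<in>I. e i > 0}"
    define u where "u = (\<lambda>i. e i - 1)"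
    define w where "w = (\<lambda>S i. u i + (if i \<in> S then 1 else 0 :: nat))"
    define Z where "Z = {S. S \<subseteq> I \<and> card S = card T}"
    \<comment> \<open>The sets in \<open>Y\<close> cover the support of \<open>u\<close>. They are
      the ones that reproduce the orbit sum of \<open>e\<close>; \<open>T\<close> itself is among
      them.\<close>
    define Y where "Y = {S\<in>Z. \<forall>i\<in>I. u i > 0 \<longrightarrow> i \<in> S}"
    have T: "T \<subseteq> I" "finite T" using I by (auto simp: T_def)
    have finX: "finite Z" "finite Y" using I by (auto simp: Z_def Y_def)
    have TY: "T \<in> Y" using T by (auto simp: Z_def Y_def u_def T_def)
    have "c ^ d * perm_sum I s u \<in> R"
      by (rule Suc.IH) (use less.prems in \<open>auto simp: u_def le_diff_conv\<close>)
    moreover have "c * esym I s (card T) \<in> R"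
      using esym T I by (simp add: card_mono)
    ultimately have "(c * esym I s (card T)) * (c ^ d * perm_sum I s u) \<in> R"
      by (rule subalgebra_mult[OF R, rotated])
    then have "c ^ Suc d * (esym I s (card T) * perm_sum I s u) \<in> R"
      by (simp add: mult_ac)
    then have main: "c ^ Suc d * (\<Sum>S\<in>Z. perm_sum I s (w S)) \<in> R"
      unfolding esym_times_perm_sum[OF I] Z_def w_def .
    have eY: "perm_sum I s (w S) = perm_sum I s e" if "S \<in> Y" for S
    proof -
      have "perm_sum I s (w S) = perm_sum I s (w T)"
        unfolding w_def
        by (rule perm_sum_cong[OF I], rule image_mset_add_indicator[OF I])
           (use that TY in \<open>auto simp: Z_def Y_def\<close>)
      also have "\<dots> = perm_sum I s e"
        unfolding perm_sum_def w_def
        by (intro sum.cong prod.cong refl) (auto simp: u_def T_def)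
      finally show ?thesis .
    qed
    \<comment> \<open>The support of \<open>w S\<close> contains \<open>S\<close> and also an index
      outside \<open>S\<close> where \<open>u\<close> is positive, so it is larger than
      \<open>T\<close>. The exponents stay within the bound because \<open>u\<close> was lowered
      first.\<close>
    have big: "c ^ Suc d * perm_sum I s (w S) \<in> R" if S: "S \<in> Z - Y" for S
    proof (rule less.hyps)
      from S obtain i where i: "i \<in> I" "u i > 0" "i \<notin> S" by (auto simp: Y_def)
      have SI: "S \<subseteq> I" "card S = card T" using S by (auto simp: Z_def)
      have "insert i S \<subseteq> {i\<in>I. w S i > 0}" using SI i by (auto simp: w_def)
      then have "card (insert i S) \<le> card {i\<in>I. w S i > 0}" using I by (intro card_mono) auto
      moreover have "card (insert i S) = Suc (card T)"
        using SI i I by (simp add: finite_subset)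
      moreover have "card {i\<in>I. w S i > 0} \<le> card I" using I by (intro card_mono) auto
      ultimately show "card I - card {i\<in>I. w S i > 0} < card I - card {i\<in>I. e i > 0}"
        by (simp add: T_def)
    next
      fix i assume "i \<in> I"
      then show "w S i \<le> Suc d" using less.prems[of i] by (auto simp: w_def u_def)
    qed
    have "(\<Sum>S\<in>Z. perm_sum I s (w S)) = (\<Sum>S\<in>Z - Y. perm_sum I s (w S)) + (\<Sum>S\<in>Y. perm_sum I s (w S))"
      by (rule sum.subset_diff) (use finX in \<open>auto simp: Y_def\<close>)
    also have "(\<Sum>S\<in>Y. perm_sum I s (w S)) = of_nat (card Y) * perm_sum I s e"
      using eY by simp
    finally have "of_nat (card Y) * (c ^ Suc d * perm_sum I s e) =
        c ^ Suc d * (\<Sum>S\<in>Z. perm_sum I s (w S)) - (\<Sum>S\<in>Z - Y. c ^ Suc d * perm_sum I s (w S))"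
      by (simp add: algebra_simps sum_distrib_left)
    also have "\<dots> \<in> R"
      by (intro subalgebra_diff[OF R] main subalgebra_sum[OF R] big)
    \<comment> \<open>Since \<open>T\<close> lies in \<open>Y\<close>, the integer
      \<open>card Y\<close> is positive and can be cancelled.\<close>
    finally show ?case
      using subalgebra_of_nat_mult_cancel[OF R, of "card Y"] TY finX card_gt_0_iff by blast
  qed
qed

text \<open>Polynomial functions with coefficients in \<open>R\<close> and degree at most
  \<open>d i\<close> in the variable \<open>i\<close>. As functions they can be evaluated at
  permuted arguments directly, and induction reduces additive claims to monomials.\<close>

inductive bounded_degree :: "'a::comm_ring_1 set \<Rightarrow> 'i set \<Rightarrow> ('i \<Rightarrow> nat) \<Rightarrow> (('i \<Rightarrow> 'a) \<Rightarrow> 'a) \<Rightarrow> bool"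
  for R I d where
  monomial: "r \<in> R \<Longrightarrow> (\<And>i. i \<in> I \<Longrightarrow> e i \<le> d i) \<Longrightarrow>
    bounded_degree R I d (\<lambda>x. r * (\<Prod>i\<in>I. x i ^ e i))"
| add: "bounded_degree R I d F \<Longrightarrow> bounded_degree R I d G \<Longrightarrow> bounded_degree R I d (\<lambda>x. F x + G x)"

lemma bounded_degree_mono:
  "bounded_degree R I d F \<Longrightarrow> (\<And>i. i \<in> I \<Longrightarrow> d i \<le> d' i) \<Longrightarrow> bounded_degree R I d' F"
  by (induction rule: bounded_degree.induct)
     (auto intro!: bounded_degree.intros intro: order_trans)

text \<open>Summing \<open>F (s \<circ> \<sigma>)\<close> over all \<open>\<sigma>\<close> turns
  each monomial of \<open>F\<close> into a \<open>perm_sum\<close>, while symmetry makes the sum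
  equal to \<open>fact (card I) * F s\<close>. Symmetry is demanded only at the point
  \<open>s\<close>, where it can be read off from values at the roots.\<close>

theorem symmetric_in_subalgebra:
  assumes R: "rational_subalgebra R" and I: "finite I"
    and esym: "\<And>k. k \<le> card I \<Longrightarrow> c * esym I s k \<in> R"
    and F: "bounded_degree R I (\<lambda>_. d) F"
    and sym: "\<And>\<sigma>. \<sigma> permutes I \<Longrightarrow> F (s \<circ> \<sigma>) = F s"
  shows "c ^ d * F s \<in> R"
proof -
  have "c ^ d * (\<Sum>\<sigma> | \<sigma> permutes I. F (s \<circ> \<sigma>)) \<in> R"
    using F
  proof induction
    case (monomial r e)
    have "r * (c ^ d * perm_sum I s e) \<in> R"
      by (intro subalgebra_mult[OF R] monomial perm_sum_in_subalgebra[OF R I esym])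
    then show ?case by (simp add: perm_sum_def sum_distrib_left mult_ac)
  next
    case (add F G)
    then show ?case by (simp add: sum.distrib distrib_left subalgebra_add[OF R])
  qed
  also have "(\<Sum>\<sigma> | \<sigma> permutes I. F (s \<circ> \<sigma>)) = of_nat (fact (card I)) * F s"
    using card_permutations[OF refl I] by (simp add: sym)
  finally show ?thesis
    using subalgebra_of_nat_mult_cancel[OF R, of "fact (card I)" "c ^ d * F s"]
    by (simp add: mult_ac)
qed

lemma bounded_degree_const: "rational_subalgebra R \<Longrightarrow> r \<in> R \<Longrightarrow> bounded_degree R I d (\<lambda>_. r)"
  using bounded_degree.monomial[of r R I "\<lambda>_. 0" d] by simp

lemma bounded_degree_mult:
  assumes R: "rational_subalgebra R" and F: "bounded_degree R I d F" and G: "bounded_degree R I d' G"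
  shows "bounded_degree R I (\<lambda>i. d i + d' i) (\<lambda>x. F x * G x)"
  using F
proof induction
  case (monomial r e)
  note re = this
  from G show ?case
  proof induction
    case (monomial r' e')
    have "bounded_degree R I (\<lambda>i. d i + d' i) (\<lambda>x. (r * r') * (\<Prod>i\<in>I. x i ^ (e i + e' i)))"
      using monomial re by (intro bounded_degree.monomial subalgebra_mult[OF R] add_mono) auto
    then show ?case by (simp add: power_add prod.distrib mult_ac)
  next
    case (add F G)
    from bounded_degree.add[OF add.IH] show ?case by (simp add: algebra_simps)
  qed
next
  case (add F G)
  from bounded_degree.add[OF add.IH] show ?case by (simp add: algebra_simps)
qed

lemma bounded_degree_sum:
  "rational_subalgebra R \<Longrightarrow> (\<And>j. j \<in> J \<Longrightarrow> bounded_degree R I d (F j)) \<Longrightarrow> bounded_degree R I d (\<lambda>x. \<Sum>j\<in>J. F j x)"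
  by (induction J rule: infinite_finite_induct)
     (simp_all add: bounded_degree_const subalgebra_0 bounded_degree.add)

lemma bounded_degree_prod:
  "rational_subalgebra R \<Longrightarrow> (\<And>j. j \<in> J \<Longrightarrow> bounded_degree R I (d j) (F j)) \<Longrightarrow>
   bounded_degree R I (\<lambda>i. \<Sum>j\<in>J. d j i) (\<lambda>x. \<Prod>j\<in>J. F j x)"
  by (induction J rule: infinite_finite_induct)
     (simp_all add: bounded_degree_const subalgebra_1 bounded_degree_mult)

lemma bounded_degree_var:
  fixes R :: "'a::comm_ring_1 set" and I :: "'i set"
  assumes R: "rational_subalgebra R" and "finite I" "j \<in> I"
  shows "bounded_degree R I (\<lambda>i. if i = j then 1 else 0) (\<lambda>x. x j)"
proof -
  have "(\<Prod>i\<in>I. x i ^ (if i = j then 1 else 0)) = x j" for x :: "'i \<Rightarrow> 'a"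
  proof -
    have "(\<Prod>i\<in>I. x i ^ (if i = j then 1 else 0)) = (\<Prod>i\<in>I. if i = j then x i else 1)"
      by (intro prod.cong) auto
    then show ?thesis using assms by simp
  qed
  then show ?thesis
    using bounded_degree.monomial[of 1 R I "\<lambda>i. if i = j then 1 else 0" "\<lambda>i. if i = j then 1 else 0"]
      subalgebra_1[OF R] by simp
qed

lemma bounded_degree_diff:
  assumes R: "rational_subalgebra R" and "bounded_degree R I d F" "bounded_degree R I d G"
  shows "bounded_degree R I d (\<lambda>x. F x - G x)"
proof -
  have "bounded_degree R I (\<lambda>i. 0 + d i) (\<lambda>x. (-1) * G x)"
    by (intro bounded_degree_mult[OF R] bounded_degree_const[OF R] assms subalgebra_uminus[OF R]
          subalgebra_1[OF R])
  from bounded_degree.add[OF assms(2) this[simplified]] show ?thesis by simp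
qed

lemma bounded_degree_power:
  "rational_subalgebra R \<Longrightarrow> bounded_degree R I d F \<Longrightarrow> bounded_degree R I (\<lambda>i. k * d i) (\<lambda>x. F x ^ k)"
  using bounded_degree_prod[of R "{..<k}" I "\<lambda>_. d" "\<lambda>_. F"] by simp

subsection \<open>Discriminants\<close>

lemma proots_prod_linear_factors: "proots (\<Prod>x\<in>#A. [:-x, 1:]) = A"
proof (induction A)
  case (add x A)
  have "(\<Prod>x\<in>#A. [:-x, 1:]) \<noteq> 0" by (auto simp: prod_mset_zero_iff)
  with add show ?case by (simp add: proots_mult del: mult_pCons_left)
qed simp

lemma enumerates_roots_imp_prod:
  assumes "p \<noteq> 0" "enumerates_roots \<rho> p"
  shows "p = Polynomial.smult (Polynomial.lead_coeff p) (\<Prod>i\<in>{1..Polynomial.degree p}. [:-\<rho> i, 1:])"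
proof -
  obtain A where A: "p = Polynomial.smult (Polynomial.lead_coeff p) (\<Prod>x\<in>#A. [:-x, 1:])"
    using alg_closed_imp_factorization[OF assms(1)] by blast
  have "proots p = proots (\<Prod>x\<in>#A. [:-x, 1:])"
    by (subst A) (use assms(1) in simp)
  also have "\<dots> = A"
    by (rule proots_prod_linear_factors)
  finally have "A = image_mset \<rho> (mset_set {1..Polynomial.degree p})"
    using assms(2) by (simp add: enumerates_roots_def)
  then show ?thesis using A
    by (simp add: image_mset.compositionality o_def prod_unfold_prod_mset)
qed

lemma enumerates_roots_prod:
  assumes "a \<noteq> 0"
  shows "enumerates_roots \<rho> (Polynomial.smult a (\<Prod>i\<in>{1..d}. [:-\<rho> i, 1:]))"
proof -
  have "Polynomial.degree (Polynomial.smult a (\<Prod>i\<in>{1..d}. [:-\<rho> i, 1:])) = d"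
    using assms by (simp add: degree_prod_eq_sum_degree)
  moreover have "proots (Polynomial.smult a (\<Prod>i\<in>{1..d}. [:-\<rho> i, 1:])) = (\<Sum>i\<in>{1..d}. {#\<rho> i#})"
    using assms by (subst proots_smult, simp, subst proots_prod) (auto intro!: sum.cong)
  moreover have "(\<Sum>i\<in>A. {#\<rho> i#}) = image_mset \<rho> (mset_set A)" for A :: "nat set"
    by (induction A rule: infinite_finite_induct) auto
  ultimately show ?thesis by (simp add: enumerates_roots_def)
qed

lemma enumerates_roots_exists:
  assumes "p \<noteq> 0"
  shows "\<exists>\<rho>. enumerates_roots \<rho> p"
proof -
  obtain A where A: "size A = Polynomial.degree p"
      "p = Polynomial.smult (Polynomial.lead_coeff p) (\<Prod>x\<in>#A. [:-x, 1:])"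
    using alg_closed_imp_factorization[OF assms] by blast
  obtain xs where xs: "mset xs = A" using ex_mset by blast
  define \<rho> where "\<rho> = (\<lambda>i. xs ! (i - 1))"
  have "image_mset \<rho> (mset_set {1..Polynomial.degree p}) = image_mset ((!) xs) (mset_set {0..<length xs})"
  proof -
    have "mset_set {1..Polynomial.degree p} = image_mset Suc (mset_set {0..<length xs})"
      using A(1) xs by (subst image_mset_mset_set) (auto simp: image_Suc_atLeastLessThan atLeastLessThanSuc_atLeastAtMost)
    then show ?thesis by (simp add: image_mset.compositionality o_def \<rho>_def)
  qed
  also have "\<dots> = mset xs"
    using arg_cong[OF map_nth[of xs], of mset] by simp
  finally have "image_mset \<rho> (mset_set {1..Polynomial.degree p}) = A"
    using xs by simp
  moreover have "proots p = A"
  proof -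
    have "proots p = proots (\<Prod>x\<in>#A. [:-x, 1:])"
      by (subst A) (use assms in simp)
    also have "\<dots> = A"
      by (rule proots_prod_linear_factors)
    finally show ?thesis .
  qed
  ultimately show ?thesis by (auto simp: enumerates_roots_def)
qed

lemma enumerates_roots_permutes:
  assumes "enumerates_roots \<rho> p" "enumerates_roots \<rho>' p"
  obtains \<sigma> where "\<sigma> permutes {1..Polynomial.degree p}"
    "\<And>i. i \<in> {1..Polynomial.degree p} \<Longrightarrow> \<rho> i = \<rho>' (\<sigma> i)"
proof -
  have "image_mset \<rho> (mset_set {1..Polynomial.degree p}) = image_mset \<rho>' (mset_set {1..Polynomial.degree p})"
    using assms by (simp only: enumerates_roots_def)
  from image_mset_eq_implies_permutes[OF _ this] obtain \<sigma> where
    "\<sigma> permutes {1..Polynomial.degree p}" "\<forall>i\<in>{1..Polynomial.degree p}. \<rho> i = \<rho>' (\<sigma> i)"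
    by blast
  then show thesis using that by blast
qed

lemma card_2_eq_Min_Max:
  fixes A :: "'a::linorder set"
  assumes "card A = 2"
  shows "A = {Min A, Max A}" "Min A < Max A"
proof -
  obtain x y where A: "A = {x, y}" "x < y"
  proof -
    obtain x y where xy: "A = {x, y}" "x \<noteq> y" using assms unfolding card_2_iff by blast
    from xy(2) consider "x < y" | "y < x" using less_linear by blast
    then show thesis
    proof cases
      case 1
      then show thesis by (rule that[OF xy(1)])
    next
      case 2
      have "A = {y, x}" using xy(1) by (simp add: insert_commute)
      then show thesis using 2 by (rule that)
    qed
  qed
  have "Min {x, y} = x" "Max {x, y} = y" using A(2) by simp_all
  then show "A = {Min A, Max A}" "Min A < Max A"
    unfolding A(1) using A(2) by (simp_all only:)
qed

text \<open>Ordered pairs \<open>i < j\<close> are not stable under permutations of the indices, but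
  two-element subsets are.\<close>

lemma prod_pairs_eq_prod_subsets:
  "(\<Prod>j\<in>{1..d}. \<Prod>i\<in>{1..<j}. \<phi> i j) =
   (\<Prod>A | A \<subseteq> {1..d} \<and> card A = 2. \<phi> (Min A) (Max A))" for d :: nat
proof -
  have "(\<Prod>j\<in>{1..d}. \<Prod>i\<in>{1..<j}. \<phi> i j) = (\<Prod>(j, i)\<in>(SIGMA j:{1..d}. {1..<j}). \<phi> i j)"
    by (subst prod.Sigma) auto
  also have "\<dots> = (\<Prod>A | A \<subseteq> {1..d} \<and> card A = 2. \<phi> (Min A) (Max A))"
  proof (rule prod.reindex_bij_witness[of _ "\<lambda>A. (Max A, Min A)" "\<lambda>(j, i). {i, j}"])
    fix A assume A: "A \<in> {A. A \<subseteq> {1..d} \<and> card A = 2}"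
    then have "card A = 2" by simp
    note eq = card_2_eq_Min_Max(1)[OF this] and less = card_2_eq_Min_Max(2)[OF this]
    have "{Min A, Max A} \<subseteq> {1..d}" using A unfolding eq[symmetric] by simp
    with less show "(Max A, Min A) \<in> (SIGMA j:{1..d}. {1..<j})" by simp
    show "(case (Max A, Min A) of (j, i) \<Rightarrow> {i, j}) = A"
      unfolding prod.case insert_commute[of "Max A"] by (rule eq[symmetric])
  next
    fix a assume "a \<in> (SIGMA j:{1..d}. {1..<j})"
    then obtain j i where a: "a = (j, i)" "j \<in> {1..d}" "1 \<le> i" "i < j" by auto
    then show "(case a of (j, i) \<Rightarrow> {i, j}) \<in> {A. A \<subseteq> {1..d} \<and> card A = 2}" by simp
    show "(Max (case a of (j, i) \<Rightarrow> {i, j}), Min (case a of (j, i) \<Rightarrow> {i, j})) = a"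
      "\<phi> (Min (case a of (j, i) \<Rightarrow> {i, j})) (Max (case a of (j, i) \<Rightarrow> {i, j})) = (case a of (j, i) \<Rightarrow> \<phi> i j)"
      using a by simp_all
  qed
  finally show ?thesis .
qed

text \<open>A permutation acts bijectively on two-element subsets. It may swap minimum and maximum,
  which the symmetry of \<open>\<phi>\<close> absorbs.\<close>

lemma prod_pairs_permute:
  assumes \<sigma>: "\<sigma> permutes {1..d::nat}" and sym: "\<And>i j. \<phi> i j = \<phi> j i"
  shows "(\<Prod>j\<in>{1..d}. \<Prod>i\<in>{1..<j}. \<phi> (\<sigma> i) (\<sigma> j)) = (\<Prod>j\<in>{1..d}. \<Prod>i\<in>{1..<j}. \<phi> i j)"
proof -
  define P where "P = {A. A \<subseteq> {1..d} \<and> card A = 2}"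
  have eq: "\<phi> (\<sigma> (Min A)) (\<sigma> (Max A)) = \<phi> (Min (\<sigma> ` A)) (Max (\<sigma> ` A))" if AP: "A \<in> P" for A
  proof -
    obtain i j where A: "A = {i, j}" using AP unfolding P_def card_2_iff by blast
    show ?thesis unfolding A by (auto simp: min_def max_def sym)
  qed
  have inj: "inj \<sigma>" by (rule permutes_inj[OF \<sigma>])
  have "bij_betw ((`) \<sigma>) P P"
    unfolding bij_betw_def
  proof
    show "inj_on ((`) \<sigma>) P" using inj by (auto intro: inj_onI simp: inj_image_eq_iff)
    then have "card ((`) \<sigma> ` P) = card P" by (rule card_image)
    moreover have "(`) \<sigma> ` P \<subseteq> P"
      using permutes_image[OF \<sigma>] inj by (auto simp: P_def card_image inj_on_subset)
    moreover have "finite P" by (simp add: P_def)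
    ultimately show "(`) \<sigma> ` P = P" by (simp add: card_subset_eq)
  qed
  from prod.reindex_bij_betw[OF this, of "\<lambda>A. \<phi> (Min A) (Max A)"]
  show ?thesis
    unfolding prod_pairs_eq_prod_subsets P_def[symmetric]
    using eq by simp
qed

text \<open>Replaces the enumeration chosen in \<open>disc\<close> by any given one: two
  enumerations differ by a permutation, under which the product of squares is invariant.\<close>

lemma disc_eq:
  assumes "enumerates_roots \<rho> g"
  shows "disc g = Polynomial.lead_coeff g ^ (2 * Polynomial.degree g - 2) *
    (\<Prod>j\<in>{1..Polynomial.degree g}. \<Prod>i\<in>{1..<j}. (\<rho> i - \<rho> j)\<^sup>2)"
proof -
  define \<rho>' where "\<rho>' = (SOME \<rho>. enumerates_roots \<rho> g)"
  have "enumerates_roots \<rho>' g" unfolding \<rho>'_def using assms by (rule someI[of "\<lambda>\<rho>. enumerates_roots \<rho> g"])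
  from enumerates_roots_permutes[OF this assms] obtain \<sigma> where
    \<sigma>: "\<sigma> permutes {1..Polynomial.degree g}" "\<And>i. i \<in> {1..Polynomial.degree g} \<Longrightarrow> \<rho>' i = \<rho> (\<sigma> i)" by blast
  have "(\<Prod>j\<in>{1..Polynomial.degree g}. \<Prod>i\<in>{1..<j}. (\<rho>' i - \<rho>' j)\<^sup>2) =
      (\<Prod>j\<in>{1..Polynomial.degree g}. \<Prod>i\<in>{1..<j}. (\<rho> (\<sigma> i) - \<rho> (\<sigma> j))\<^sup>2)"
    by (intro prod.cong refl) (auto simp: \<sigma>(2))
  also have "\<dots> = (\<Prod>j\<in>{1..Polynomial.degree g}. \<Prod>i\<in>{1..<j}. (\<rho> i - \<rho> j)\<^sup>2)"
    by (rule prod_pairs_permute[OF \<sigma>(1)]) (simp add: power2_commute)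
  finally show ?thesis by (simp add: disc_def Let_def \<rho>'_def)
qed

text \<open>Each unordered pair occurs in both orders. With \<open>g i k = r i - r k\<close> this
  turns the product of the values of the derivative at the roots into a discriminant up to
  sign.\<close>

lemma prod_off_diagonal:
  fixes g :: "nat \<Rightarrow> nat \<Rightarrow> 'a::comm_monoid_mult"
  shows "(\<Prod>i\<in>{1..d}. \<Prod>k\<in>{1..d} - {i}. g i k) = (\<Prod>j\<in>{1..d}. \<Prod>i\<in>{1..<j}. g i j * g j i)"
proof (induction d)
  case (Suc d)
  have "(\<Prod>i\<in>{1..Suc d}. \<Prod>k\<in>{1..Suc d} - {i}. g i k) =
      (\<Prod>i\<in>{1..d}. \<Prod>k\<in>{1..Suc d} - {i}. g i k) * (\<Prod>k\<in>{1..Suc d} - {Suc d}. g (Suc d) k)"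
    by simp
  also have "{1..Suc d} - {Suc d} = {1..d}" by auto
  also have "(\<Prod>i\<in>{1..d}. \<Prod>k\<in>{1..Suc d} - {i}. g i k) =
      (\<Prod>i\<in>{1..d}. g i (Suc d) * (\<Prod>k\<in>{1..d} - {i}. g i k))"
  proof (intro prod.cong refl)
    fix i assume "i \<in> {1..d}"
    then have "{1..Suc d} - {i} = insert (Suc d) ({1..d} - {i})" by auto
    then show "(\<Prod>k\<in>{1..Suc d} - {i}. g i k) = g i (Suc d) * (\<Prod>k\<in>{1..d} - {i}. g i k)"
      by simp
  qed
  also have "\<dots> = (\<Prod>i\<in>{1..d}. g i (Suc d)) * (\<Prod>j\<in>{1..d}. \<Prod>i\<in>{1..<j}. g i j * g j i)"
    by (simp only: prod.distrib Suc.IH)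
  also have "\<dots> * (\<Prod>k\<in>{1..d}. g (Suc d) k) =
      (\<Prod>j\<in>{1..Suc d}. \<Prod>i\<in>{1..<j}. g i j * g j i)"
    by (simp add: prod.distrib atLeastLessThanSuc_atLeastAtMost mult_ac)
  finally show ?case .
qed simp

lemma prod_pairs_const: "(\<Prod>j\<in>{1..d}. \<Prod>i\<in>{1..<j}. a) = a ^ (d choose 2)" for d :: nat
  by (induction d) (simp_all add: power_add numeral_2_eq_2 mult.commute)

lemma degree_pderiv_CHAR_0:
  fixes p :: "'a::idom poly"
  assumes "CHAR('a) = 0"
  shows "Polynomial.degree (pderiv p) = Polynomial.degree p - 1"
proof (cases "Polynomial.degree p")
  case 0
  then obtain a where "p = [:a:]" by (rule degree_eq_zeroE)
  then show ?thesis by (simp add: pderiv_pCons)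
next
  case (Suc k)
  then have "p \<noteq> 0" by auto
  then have "poly.coeff (pderiv p) k \<noteq> 0"
    using assms Suc leading_coeff_neq_0[of p]
    by (simp add: coeff_pderiv of_nat_eq_0_iff_char_dvd del: of_nat_Suc)
  then have "k \<le> Polynomial.degree (pderiv p)" by (rule le_degree)
  moreover have "Polynomial.degree (pderiv p) \<le> k"
    by (rule degree_le) (use Suc in \<open>auto simp: coeff_pderiv coeff_eq_0\<close>)
  ultimately show ?thesis using Suc by simp
qed

text \<open>
  Both sides of the resultant identity \<open>a\<^sup>m \<Prod> f'(r\<^sub>i) = c\<^sup>n \<Prod> f(s\<^sub>j)\<close> are products of the
  differences \<open>r\<^sub>i - s\<^sub>j\<close>; no sign appears because \<open>n * (n - 1)\<close> is even.
\<close>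

lemma disc_eq_prod_critical_values:
  fixes f :: "'a::alg_closed_field poly"
  assumes char: "CHAR('a) = 0"
    and n: "Polynomial.degree f = n" "n \<ge> 1" and s: "enumerates_roots s (pderiv f)"
  obtains k where "disc f = (-1) ^ k * of_nat n * (of_nat n * Polynomial.lead_coeff f) ^ (n - 1) *
    (\<Prod>j\<in>{1..n-1}. poly f (s j))"
proof -
  define a where "a = Polynomial.lead_coeff f"
  define c where "c = of_nat n * a"
  define m where "m = n - 1"
  have nm: "n = Suc m" using n(2) by (simp add: m_def)
  have f0: "f \<noteq> 0" using n by auto
  have a0: "a \<noteq> 0" using f0 by (simp add: a_def)
  have c0: "c \<noteq> 0" using a0 n(2) char by (simp add: c_def of_nat_eq_0_iff_char_dvd)
  have degf': "Polynomial.degree (pderiv f) = m"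
    using degree_pderiv_CHAR_0[OF char, of f] n by (simp add: m_def)
  have lcf': "Polynomial.lead_coeff (pderiv f) = c"
    unfolding degf' using n by (simp add: coeff_pderiv nm c_def a_def)
  have f'0: "pderiv f \<noteq> 0" using lcf' c0 by auto
  obtain r where r: "enumerates_roots r f" using enumerates_roots_exists[OF f0] by blast
  have f: "f = Polynomial.smult a (\<Prod>i\<in>{1..n}. [:-r i, 1:])"
    using enumerates_roots_imp_prod[OF f0 r] n by (simp add: a_def)
  have f': "pderiv f = Polynomial.smult c (\<Prod>j\<in>{1..m}. [:-s j, 1:])"
    using enumerates_roots_imp_prod[OF f'0 s] degf' lcf' by simp
  have f'r: "poly (pderiv f) (r i) = a * (\<Prod>k\<in>{1..n} - {i}. r i - r k)" if "i \<in> {1..n}" for i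
  proof -
    have "poly (pderiv f) (r i) = a * (\<Sum>k\<in>{1..n}. \<Prod>l\<in>{1..n} - {k}. r i - r l)"
      by (subst f) (simp add: pderiv_smult pderiv_prod poly_sum poly_prod pderiv_pCons)
    \<comment> \<open>In the product rule only the summand that omits the factor of
      \<open>r i\<close> survives; every other one contains \<open>r i - r i\<close>.\<close>
    also have "(\<Sum>k\<in>{1..n}. \<Prod>l\<in>{1..n} - {k}. r i - r l) =
        (\<Sum>k\<in>{1..n}. if k = i then \<Prod>l\<in>{1..n} - {i}. r i - r l else 0)"
      using that by (intro sum.cong refl) (auto intro!: prod_zero)
    finally show ?thesis using that by simp
  qed
  have "(\<Prod>i\<in>{1..n}. poly (pderiv f) (r i)) = a ^ n * (\<Prod>i\<in>{1..n}. \<Prod>k\<in>{1..n} - {i}. r i - r k)"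
    using f'r by (simp add: prod.distrib)
  also have "(\<Prod>i\<in>{1..n}. \<Prod>k\<in>{1..n} - {i}. r i - r k) =
      (\<Prod>j\<in>{1..n}. \<Prod>i\<in>{1..<j}. (-1) * (r i - r j)\<^sup>2)"
    unfolding prod_off_diagonal
    by (intro prod.cong refl) (simp add: power2_eq_square algebra_simps)
  also have "\<dots> = (-1) ^ (n choose 2) * (\<Prod>j\<in>{1..n}. \<Prod>i\<in>{1..<j}. (r i - r j)\<^sup>2)"
    by (simp only: prod.distrib prod_pairs_const)
  finally have 1: "(\<Prod>i\<in>{1..n}. poly (pderiv f) (r i)) =
      a ^ n * ((-1) ^ (n choose 2) * (\<Prod>j\<in>{1..n}. \<Prod>i\<in>{1..<j}. (r i - r j)\<^sup>2))" .
  have 2: "(\<Prod>i\<in>{1..n}. poly (pderiv f) (r i)) = c ^ n * (\<Prod>i\<in>{1..n}. \<Prod>j\<in>{1..m}. r i - s j)"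
    by (subst f') (simp add: poly_prod prod.distrib)
  have "(\<Prod>j\<in>{1..m}. poly f (s j)) = a ^ m * (\<Prod>j\<in>{1..m}. \<Prod>i\<in>{1..n}. s j - r i)"
    by (subst f) (simp add: poly_prod prod.distrib)
  also have "(\<Prod>j\<in>{1..m}. \<Prod>i\<in>{1..n}. s j - r i) = (\<Prod>j\<in>{1..m}. \<Prod>i\<in>{1..n}. -1 * (r i - s j))"
    by simp
  also have "\<dots> = ((-1) ^ n) ^ m * (\<Prod>j\<in>{1..m}. \<Prod>i\<in>{1..n}. r i - s j)"
    by (simp only: prod.distrib prod_constant card_atLeastAtMost) simp
  also have "((-1) ^ n) ^ m = (1::'a)"
    unfolding power_mult[symmetric] by (simp add: nm)
  also have "(\<Prod>j\<in>{1..m}. \<Prod>i\<in>{1..n}. r i - s j) = (\<Prod>i\<in>{1..n}. \<Prod>j\<in>{1..m}. r i - s j)"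
    by (rule prod.swap)
  finally have 3: "(\<Prod>j\<in>{1..m}. poly f (s j)) = a ^ m * (\<Prod>i\<in>{1..n}. \<Prod>j\<in>{1..m}. r i - s j)"
    by simp
  define V where "V = (\<Prod>j\<in>{1..n}. \<Prod>i\<in>{1..<j}. (r i - r j)\<^sup>2)"
  define W where "W = (\<Prod>i\<in>{1..n}. \<Prod>j\<in>{1..m}. r i - s j)"
  define \<epsilon> where "\<epsilon> = ((-1) ^ (n choose 2) :: 'a)"
  have \<epsilon>: "\<epsilon> * \<epsilon> = 1" by (simp add: \<epsilon>_def flip: power_add)
  have "a ^ n * V = \<epsilon> * c ^ n * W"
  proof -
    have "a ^ n * (\<epsilon> * V) = c ^ n * W" using 1 2 by (simp add: V_def W_def \<epsilon>_def)
    then have "\<epsilon> * (a ^ n * (\<epsilon> * V)) = \<epsilon> * (c ^ n * W)" by simp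
    then have "(\<epsilon> * \<epsilon>) * (a ^ n * V) = \<epsilon> * c ^ n * W" by (simp only: mult_ac)
    then show ?thesis using \<epsilon> by simp
  qed
  have "disc f = a ^ (2 * n - 2) * V"
    using disc_eq[OF r] n by (simp add: a_def V_def)
  \<comment> \<open>One extra factor \<open>a\<close> completes the exponent
    \<open>2 * n - 2\<close> to \<open>m + n\<close>, so that the relation for
    \<open>a ^ n * V\<close> applies; it is cancelled at the end.\<close>
  then have "a * disc f = a ^ m * (a ^ n * V)"
    by (simp add: nm mult_2 power_add)
  also have "\<dots> = a * (\<epsilon> * of_nat n * c ^ m * (a ^ m * W))"
    unfolding \<open>a ^ n * V = _\<close> by (simp add: nm c_def mult_ac)
  finally have "disc f = \<epsilon> * of_nat n * c ^ m * (a ^ m * W)"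
    using a0 by simp
  then show thesis
    using 3 by (intro that[of "n choose 2"]) (simp add: \<epsilon>_def c_def a_def m_def W_def)
qed

subsection \<open>Integrality of products over the roots\<close>

text \<open>Vieta: up to sign this is the coefficient of degree \<open>card I - k\<close>, as the
  expansion of the product over subsets of \<open>I\<close> shows.\<close>

lemma esym_in_subalgebra:
  assumes R: "rational_subalgebra R" and I: "finite I"
    and coeffs: "\<And>k. poly.coeff (Polynomial.smult c (\<Prod>i\<in>I. [:-s i, 1:])) k \<in> R"
    and k: "k \<le> card I"
  shows "c * esym I s k \<in> R"
proof -
  have "(\<Prod>i\<in>I. [:-s i, 1:]) = (\<Prod>i\<in>I. [:-s i:] + [:0, 1:])" by simp
  also have "\<dots> = (\<Sum>S\<in>Pow I. (\<Prod>i\<in>S. [:-s i:]) * (\<Prod>i\<in>I - S. [:0, 1:]))"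
    by (rule prod_add[OF I])
  also have "\<dots> = (\<Sum>S\<in>Pow I. Polynomial.monom (\<Prod>i\<in>S. -s i) (card (I - S)))"
  proof (intro sum.cong refl)
    fix S
    have "(\<Prod>i\<in>S. [:-s i:]) = [:\<Prod>i\<in>S. -s i:]"
      by (induction S rule: infinite_finite_induct) (auto simp: one_pCons)
    then show "(\<Prod>i\<in>S. [:-s i:]) * (\<Prod>i\<in>I - S. [:0, 1:]) =
        Polynomial.monom (\<Prod>i\<in>S. -s i) (card (I - S))"
      by (simp add: monom_altdef)
  qed
  finally have "poly.coeff (\<Prod>i\<in>I. [:-s i, 1:]) (card I - k) =
      (\<Sum>S\<in>Pow I. if card (I - S) = card I - k then \<Prod>i\<in>S. -s i else 0)"
    by (simp add: coeff_sum)
  also have "\<dots> = (\<Sum>S | S \<subseteq> I \<and> card S = k. \<Prod>i\<in>S. -s i)"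
  proof (rule sum.mono_neutral_cong_right)
    show "\<forall>S\<in>Pow I - {S. S \<subseteq> I \<and> card S = k}.
        (if card (I - S) = card I - k then \<Prod>i\<in>S. -s i else 0) = 0"
    proof
      fix S assume S: "S \<in> Pow I - {S. S \<subseteq> I \<and> card S = k}"
      then have "card (I - S) = card I - card S" "card S \<le> card I"
        using I by (auto simp: card_Diff_subset finite_subset card_mono)
      then show "(if card (I - S) = card I - k then \<Prod>i\<in>S. -s i else 0) = 0"
        using S k by auto
    qed
  qed (use I in \<open>auto simp: card_Diff_subset finite_subset\<close>)
  also have "\<dots> = (-1) ^ k * esym I s k"
    unfolding esym_def sum_distrib_left by (intro sum.cong refl) (auto simp: prod_uminus)
  finally have "c * esym I s k = (-1) ^ k * poly.coeff (Polynomial.smult c (\<Prod>i\<in>I. [:-s i, 1:])) (card I - k)"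
    by (simp add: mult_ac flip: power_mult_distrib mult.assoc[of "(-1) ^ k"])
  then show ?thesis
    by (simp only:) (intro subalgebra_mult[OF R] subalgebra_power[OF R]
        subalgebra_uminus[OF R] subalgebra_1[OF R] coeffs)
qed

text \<open>The product is symmetric in the roots and of degree at most \<open>d\<close> in each.
  The symmetric polynomial theorem is applied over the ring of polynomials with coefficients in
  \<open>R\<close>, with \<open>c\<close> and the roots as constant polynomials.\<close>

lemma coeff_prod_linear_in_subalgebra:
  fixes s :: "'i \<Rightarrow> 'a::comm_ring_1"
  assumes R: "rational_subalgebra R" and I: "finite I"
    and esym: "\<And>k. k \<le> card I \<Longrightarrow> c * esym I s k \<in> R"
    and \<phi>: "\<And>k. poly.coeff \<phi> k \<in> R" "Polynomial.degree \<phi> \<le> d"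
  shows "c ^ d * poly.coeff (\<Prod>j\<in>I. [:poly \<phi> (s j), 1:]) k \<in> R"
proof -
  define R' where "R' = {p. \<forall>k. poly.coeff p k \<in> R}"
  have R': "rational_subalgebra R'" unfolding R'_def by (rule rational_subalgebra_poly[OF R])
  have constR': "[:x:] \<in> R'" if "x \<in> R" for x
    using that by (auto simp: R'_def coeff_pCons subalgebra_0[OF R] split: nat.split)
  define F where "F = (\<lambda>x. \<Prod>j\<in>I. [:0, 1:] + (\<Sum>i\<le>d. [:poly.coeff \<phi> i:] * x j ^ i))"
  have "bounded_degree R' I (\<lambda>i. \<Sum>j\<in>I. if i = j then d else 0) F"
    unfolding F_def
  proof (intro bounded_degree_prod[OF R'] bounded_degree.add bounded_degree_sum[OF R'])
    fix j assume "j \<in> I"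
    show "bounded_degree R' I (\<lambda>i. if i = j then d else 0) (\<lambda>x. [:0, 1:])"
      by (intro bounded_degree_const[OF R'])
         (auto simp: R'_def coeff_pCons subalgebra_0[OF R] subalgebra_1[OF R] split: nat.split)
    fix i assume "i \<in> {..d}"
    have "bounded_degree R' I (\<lambda>l. 0 + i * (if l = j then 1 else 0)) (\<lambda>x. [:poly.coeff \<phi> i:] * x j ^ i)"
      by (intro bounded_degree_mult[OF R'] bounded_degree_const[OF R'] constR' \<phi>
            bounded_degree_power[OF R'] bounded_degree_var[OF R'] I \<open>j \<in> I\<close>)
    then show "bounded_degree R' I (\<lambda>i. if i = j then d else 0) (\<lambda>x. [:poly.coeff \<phi> i:] * x j ^ i)"
      by (rule bounded_degree_mono) (use \<open>i \<in> {..d}\<close> in auto)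
  qed
  then have deg: "bounded_degree R' I (\<lambda>_. d) F"
    by (rule bounded_degree_mono) (use I in auto)
  have "[:c:] ^ d * F (\<lambda>j. [:s j:]) \<in> R'"
  proof (rule symmetric_in_subalgebra[OF R' I _ deg])
    fix k assume "k \<le> card I"
    have "(\<Prod>i\<in>S. [:s i:]) = [:\<Prod>i\<in>S. s i:]" for S :: "'i set"
      by (induction S rule: infinite_finite_induct) (auto simp: one_pCons)
    moreover have "(\<Sum>S\<in>Z. [:g S:]) = [:\<Sum>S\<in>Z. g S:]" for Z and g :: "'i set \<Rightarrow> 'a"
      by (induction Z rule: infinite_finite_induct) auto
    ultimately have "[:c:] * esym I (\<lambda>j. [:s j:]) k = [:c * esym I s k:]"
      by (simp add: esym_def)
    then show "[:c:] * esym I (\<lambda>j. [:s j:]) k \<in> R'"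
      using constR'[OF esym[OF \<open>k \<le> card I\<close>]] by simp
  next
    fix \<sigma> assume "\<sigma> permutes I"
    from prod.permute[OF this, of "\<lambda>j. [:0, 1:] + (\<Sum>i\<le>d. [:poly.coeff \<phi> i:] * [:s j:] ^ i)"]
    show "F ((\<lambda>j. [:s j:]) \<circ> \<sigma>) = F (\<lambda>j. [:s j:])"
      by (simp add: F_def o_def)
  qed
  also have "F (\<lambda>j. [:s j:]) = (\<Prod>j\<in>I. [:poly \<phi> (s j), 1:])"
    unfolding F_def
  proof (intro prod.cong refl)
    fix j
    have "poly \<phi> (s j) = (\<Sum>i\<le>d. poly.coeff \<phi> i * s j ^ i)"
      unfolding poly_altdef using \<phi>(2)
      by (intro sum.mono_neutral_left) (auto simp: coeff_eq_0)
    moreover have "(\<Sum>i\<in>A. [:g i:]) = [:\<Sum>i\<in>A. g i:]" for A :: "nat set" and g :: "nat \<Rightarrow> 'a"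
      by (induction A rule: infinite_finite_induct) auto
    ultimately show "[:0, 1:] + (\<Sum>i\<le>d. [:poly.coeff \<phi> i:] * [:s j:] ^ i) = [:poly \<phi> (s j), 1:]"
      by (simp add: poly_const_pow mult.commute)
  qed
  finally have "\<forall>k. poly.coeff ([:c:] ^ d * (\<Prod>j\<in>I. [:poly \<phi> (s j), 1:])) k \<in> R"
    by (simp add: R'_def)
  then show ?thesis by (simp add: poly_const_pow)
qed

text \<open>The index \<open>k\<close> belongs to \<open>m - 1\<close> pairs and is avoided by
  \<open>(m - 1) choose 2\<close> of them. The sum is the degree in the \<open>k\<close>-th variable
  of a product over pairs.\<close>

lemma sum_pairs_degree:
  fixes m k M L :: nat
  assumes "k \<in> {1..m}"
  shows "(\<Sum>j\<in>{1..m}. \<Sum>i\<in>{1..<j}. if k = i \<or> k = j then M else L) =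
    (m - 1) * M + ((m - 1) choose 2) * L"
  using assms
proof (induction m)
  case (Suc m)
  have const: "(\<Sum>j\<in>{1..m}. \<Sum>i\<in>{1..<j}. L) = (m choose 2) * L" for m
    by (induction m) (simp_all add: numeral_2_eq_2 algebra_simps)
  show ?case
  proof (cases "k = Suc m")
    case True
    have "(\<Sum>j\<in>{1..m}. \<Sum>i\<in>{1..<j}. if k = i \<or> k = j then M else L) =
        (\<Sum>j\<in>{1..m}. \<Sum>i\<in>{1..<j}. L)"
      using True by (intro sum.cong refl) auto
    then show ?thesis using True const by simp
  next
    case False
    then have k: "k \<in> {1..m}" using Suc.prems by auto
    then obtain m' where m': "m = Suc m'" by (cases m) auto
    have "(\<Sum>i\<in>{1..m}. if k = i then M else L) = M + (\<Sum>i\<in>{1..m} - {k}. L)"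
      using k by (subst sum.remove[of _ k]) auto
    then have "(\<Sum>i\<in>{1..<Suc m}. if k = i \<or> k = Suc m then M else L) = M + (m - 1) * L"
      using k False by (simp add: atLeastLessThanSuc_atLeastAtMost)
    moreover have "(m - 1) * M + ((m - 1) choose 2) * L + (M + (m - 1) * L) = m * M + (m choose 2) * L"
      by (simp add: m' numeral_2_eq_2 algebra_simps)
    ultimately show ?thesis using Suc.IH[OF k] by simp
  qed
qed simp

text \<open>\<open>M\<close> bounds the degree of the factor of a pair in its own two variables,
  \<open>L\<close> the degree in each other variable. The power of \<open>c\<close> is the resulting
  total degree in one variable.\<close>

lemma prod_pairs_in_subalgebra:
  fixes s :: "nat \<Rightarrow> 'a::comm_ring_1"
  assumes R: "rational_subalgebra R"
    and esym: "\<And>k. k \<le> m \<Longrightarrow> c * esym {1..m} s k \<in> R"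
    and J: "\<And>i j. i \<in> {1..m} \<Longrightarrow> j \<in> {1..m} \<Longrightarrow> i \<noteq> j \<Longrightarrow>
      bounded_degree R {1..m} (\<lambda>k. if k = i \<or> k = j then M else L) (J i j)"
    and sym: "\<And>\<sigma>. \<sigma> permutes {1..m} \<Longrightarrow>
      (\<Prod>j\<in>{1..m}. \<Prod>i\<in>{1..<j}. J i j (s \<circ> \<sigma>)) = (\<Prod>j\<in>{1..m}. \<Prod>i\<in>{1..<j}. J i j s)"
  shows "c ^ ((m - 1) * M + ((m - 1) choose 2) * L) * (\<Prod>j\<in>{1..m}. \<Prod>i\<in>{1..<j}. J i j s) \<in> R"
proof -
  have "bounded_degree R {1..m} (\<lambda>k. \<Sum>j\<in>{1..m}. \<Sum>i\<in>{1..<j}. if k = i \<or> k = j then M else L)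
      (\<lambda>x. \<Prod>j\<in>{1..m}. \<Prod>i\<in>{1..<j}. J i j x)"
    by (intro bounded_degree_prod[OF R] J) auto
  then have "bounded_degree R {1..m} (\<lambda>_. (m - 1) * M + ((m - 1) choose 2) * L)
      (\<lambda>x. \<Prod>j\<in>{1..m}. \<Prod>i\<in>{1..<j}. J i j x)"
    by (rule bounded_degree_mono) (simp only: sum_pairs_degree order_refl)
  from symmetric_in_subalgebra[OF R _ _ this sym, of c] esym show ?thesis by simp
qed

text \<open>
  \<open>moment N p\<close> is the integral of \<open>p\<close> over the unit interval if \<open>degree p < N\<close>, so
  \<open>difference_quotient N I i j s\<close> is the integral of
  \<open>t (t - 1) \<Prod> (s\<^sub>j - s\<^sub>l + (s\<^sub>i - s\<^sub>j) t)\<close>, where \<open>l\<close> ranges over \<open>I - {i, j}\<close>.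
\<close>

definition moment :: "nat \<Rightarrow> 'a::field poly \<Rightarrow> 'a" where
  "moment N p = (\<Sum>k<N. poly.coeff p k * inverse (of_nat (Suc k)))"

definition difference_quotient :: "nat \<Rightarrow> 'i set \<Rightarrow> 'i \<Rightarrow> 'i \<Rightarrow> ('i \<Rightarrow> 'a::field) \<Rightarrow> 'a" where
  "difference_quotient N I i j s =
     moment N ([:0, -1, 1:] * (\<Prod>l\<in>I - {i, j}. [:s j - s l, s i - s j:]))"

text \<open>The fundamental theorem of calculus on the unit interval: the factor
  \<open>Suc k\<close> from differentiation cancels the weight in \<open>moment\<close>.\<close>

lemma moment_pderiv:
  fixes p :: "'a::field poly"
  assumes char: "CHAR('a) = 0" and "Polynomial.degree p \<le> N"
  shows "moment N (pderiv p) = poly p 1 - poly p 0"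
proof -
  have "poly p 1 = (\<Sum>k\<le>N. poly.coeff p k)"
    unfolding poly_altdef using assms(2) by (simp, intro sum.mono_neutral_left) (auto simp: coeff_eq_0)
  also have "\<dots> = poly.coeff p 0 + (\<Sum>k<N. poly.coeff p (Suc k))"
    by (rule sum.atMost_shift)
  finally have "poly p 1 - poly p 0 = (\<Sum>k<N. poly.coeff p (Suc k))"
    by (simp add: poly_0_coeff_0)
  moreover have "(of_nat (Suc k) :: 'a) \<noteq> 0" for k
    using char by (simp only: of_nat_eq_0_iff_char_dvd) simp
  ultimately show ?thesis
    by (simp add: moment_def coeff_pderiv field_simps del: of_nat_Suc)
qed

text \<open>Put \<open>u = s i - s j\<close> and substitute \<open>s j + u * t\<close> into
  \<open>f\<close>. The factors of the derivative at \<open>s i\<close> and \<open>s j\<close>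
  become \<open>u * (t - 1)\<close> and \<open>u * t\<close>, and the chain rule gives a third
  \<open>u\<close>: this is the cube. Integration over \<open>t\<close> then yields the difference
  of values.\<close>

lemma diff_critical_values:
  fixes f :: "'a::field poly"
  assumes char: "CHAR('a) = 0"
    and f': "pderiv f = Polynomial.smult c (\<Prod>l\<in>I. [:-s l, 1:])"
    and I: "finite I" "i \<in> I" "j \<in> I" "i \<noteq> j" and N: "Polynomial.degree f \<le> N"
  shows "poly f (s i) - poly f (s j) = c * (s i - s j) ^ 3 * difference_quotient N I i j s"
proof -
  define u where "u = s i - s j"
  define g where "g = pcompose f [:s j, u:]"
  define Q where "Q = (\<Prod>l\<in>I - {i, j}. [:s j - s l, u:])"
  have linear: "pcompose [:-x, 1:] [:y, u:] = [:y - x, u:]" for x y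
    by (simp add: pcompose_pCons)
  have ui: "s j - s i = -u" by (simp add: u_def)
  have "I = insert i (insert j (I - {i, j}))" using I by auto
  then have "(\<Prod>l\<in>I. [:-s l, 1:]) = (\<Prod>l\<in>insert i (insert j (I - {i, j})). [:-s l, 1:])"
    by (rule arg_cong)
  then have "pderiv f = Polynomial.smult c ([:-s i, 1:] * ([:-s j, 1:] * (\<Prod>l\<in>I - {i, j}. [:-s l, 1:])))"
    unfolding f' using I by (simp del: mult_pCons_left mult_pCons_right)
  then have "pcompose (pderiv f) [:s j, u:] = Polynomial.smult c ([:-u, u:] * ([:0, u:] * Q))"
    by (simp add: pcompose_smult pcompose_mult pcompose_prod linear ui Q_def
         del: mult_pCons_left mult_pCons_right pcompose_pCons)
  then have "pderiv g = Polynomial.smult c ([:-u, u:] * ([:0, u:] * Q)) * [:u:]"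
    by (simp add: g_def pderiv_pcompose pderiv_pCons del: mult_pCons_left mult_pCons_right)
  also have "\<dots> = Polynomial.smult (c * u ^ 3) ([:0, -1, 1:] * Q)"
    by (simp add: power3_eq_cube smult_diff_right mult_ac)
  finally have "moment N (pderiv g) = c * u ^ 3 * moment N ([:0, -1, 1:] * Q)"
    by (simp only: moment_def Polynomial.coeff_smult sum_distrib_left mult.assoc)
  moreover have "moment N (pderiv g) = poly g 1 - poly g 0"
  proof (rule moment_pderiv[OF char])
    have "Polynomial.degree g \<le> Polynomial.degree f * Polynomial.degree [:s j, u:]"
      unfolding g_def by (rule degree_pcompose_le)
    also have "\<dots> \<le> Polynomial.degree f" by simp
    finally show "Polynomial.degree g \<le> N" using N by simp
  qed
  ultimately show ?thesis
    by (simp add: g_def poly_pcompose u_def Q_def difference_quotient_def)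
qed

lemma bounded_degree_coeff_mult:
  assumes R: "rational_subalgebra R"
    and "\<And>k. bounded_degree R I d (\<lambda>x. poly.coeff (p x) k)"
    and "\<And>k. bounded_degree R I d' (\<lambda>x. poly.coeff (q x) k)"
  shows "bounded_degree R I (\<lambda>i. d i + d' i) (\<lambda>x. poly.coeff (p x * q x) k)"
  unfolding coeff_mult by (intro bounded_degree_sum[OF R] bounded_degree_mult[OF R] assms)

lemma bounded_degree_coeff_prod:
  assumes R: "rational_subalgebra R"
    and "\<And>j k. j \<in> J \<Longrightarrow> bounded_degree R I (d j) (\<lambda>x. poly.coeff (p j x) k)"
  shows "bounded_degree R I (\<lambda>i. \<Sum>j\<in>J. d j i) (\<lambda>x. poly.coeff (\<Prod>j\<in>J. p j x) k)"
  using assms(2)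
proof (induction J arbitrary: k rule: infinite_finite_induct)
  case (insert j J)
  show ?case
    using bounded_degree_coeff_mult[OF R insert.prems[of j] insert.IH] insert by simp
qed (auto intro!: bounded_degree_const[OF R] subalgebra_0[OF R] subalgebra_1[OF R] simp: coeff_1)

text \<open>Each \<open>l\<close> other than \<open>i\<close> and \<open>j\<close> contributes a
  factor with coefficients linear in the variables \<open>i\<close>, \<open>j\<close>,
  \<open>l\<close>; integration only adds rational weights.\<close>

lemma bounded_degree_difference_quotient:
  fixes R :: "'a::field set"
  assumes char: "CHAR('a) = 0" and R: "rational_subalgebra R" and I: "finite I" "i \<in> I" "j \<in> I" "i \<noteq> j"
  shows "bounded_degree R I (\<lambda>k. if k = i \<or> k = j then card I - 2 else 1) (difference_quotient N I i j)"
proof -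
  have inv: "inverse (of_nat (Suc k)) \<in> R" for k
    using subalgebra_of_nat_mult_cancel[OF R, of "Suc k" "inverse (of_nat (Suc k))"]
      subalgebra_1[OF R] char by (simp add: of_nat_eq_0_iff_char_dvd del: of_nat_Suc)
  define d where "d = (\<lambda>l k. if k = i \<or> k = j \<or> k = l then 1 else 0 :: nat)"
  have var: "bounded_degree R I (d l) (\<lambda>x. x k)" if "k \<in> {i, j, l}" "l \<in> I" for k l
  proof -
    have "bounded_degree R I (\<lambda>k'. if k' = k then 1 else 0) (\<lambda>x. x k)"
      by (rule bounded_degree_var[OF R I(1)]) (use that I in auto)
    then show ?thesis by (rule bounded_degree_mono) (use that in \<open>auto simp: d_def\<close>)
  qed
  have "bounded_degree R I (\<lambda>k. \<Sum>l\<in>I - {i, j}. d l k)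
      (\<lambda>x. poly.coeff (\<Prod>l\<in>I - {i, j}. [:x j - x l, x i - x j:]) k)" for k
  proof (rule bounded_degree_coeff_prod[OF R])
    fix l k assume "l \<in> I - {i, j}"
    then show "bounded_degree R I (d l) (\<lambda>x. poly.coeff [:x j - x l, x i - x j:] k)"
      by (cases k; cases "k - 1")
         (auto intro!: bounded_degree_diff[OF R] var bounded_degree_const[OF R] subalgebra_0[OF R])
  qed
  then have "bounded_degree R I (\<lambda>k. 0 + (\<Sum>l\<in>I - {i, j}. d l k) + 0)
      (\<lambda>x. poly.coeff ([:0, -1, 1:] * (\<Prod>l\<in>I - {i, j}. [:x j - x l, x i - x j:])) k
        * inverse (of_nat (Suc k)))" for k
    by (intro bounded_degree_mult[OF R] bounded_degree_coeff_mult[OF R] bounded_degree_const[OF R] inv)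
       (auto simp: coeff_pCons subalgebra_0[OF R] subalgebra_1[OF R] subalgebra_uminus[OF R]
         split: nat.split)
  then have "bounded_degree R I (\<lambda>k. 0 + (\<Sum>l\<in>I - {i, j}. d l k) + 0) (difference_quotient N I i j)"
    unfolding difference_quotient_def moment_def by (intro bounded_degree_sum[OF R])
  then show ?thesis
  proof (rule bounded_degree_mono)
    fix k assume k: "k \<in> I"
    show "0 + (\<Sum>l\<in>I - {i, j}. d l k) + 0 \<le> (if k = i \<or> k = j then card I - 2 else 1)"
    proof (cases "k = i \<or> k = j")
      case True
      then have "(\<Sum>l\<in>I - {i, j}. d l k) = card (I - {i, j})" by (auto simp: d_def)
      then show ?thesis using True I by (simp add: card_Diff_subset)
    next
      case False
      then have "(\<Sum>l\<in>I - {i, j}. d l k) = (\<Sum>l\<in>I - {i, j}. if k = l then 1 else 0)"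
        by (auto simp: d_def)
      also have "\<dots> \<le> 1" using I by simp
      finally show ?thesis using False by simp
    qed
  qed
qed

lemma cubic_quotient_commute:
  "(a - b) / (c * (x - y) ^ 3) = (b - a) / (c * (y - x) ^ 3)" for a :: "'a::field"
proof -
  have "c * (x - y) ^ 3 = - (c * (y - x) ^ 3)"
    by (simp add: power3_eq_cube algebra_simps)
  moreover have "a - b = - (b - a)" by simp
  ultimately show ?thesis by (simp only: minus_divide_divide)
qed

text \<open>Injectivity of \<open>s\<close> keeps the denominators nonzero, so each quotient equals
  the polynomial \<open>difference_quotient\<close>. The exponent of \<open>c\<close> counts degree
  \<open>m - 2\<close> for the \<open>m - 1\<close> pairs containing a given root and degree 1 for
  the others.\<close>

lemma prod_critical_difference_quotients_polynomial:
  fixes f :: "qclosure poly" and s :: "nat \<Rightarrow> qclosure"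
  assumes coeffs: "\<And>k. poly.coeff (pderiv f) k \<in> emb ` qpolys_in K"
    and f': "pderiv f = Polynomial.smult c (\<Prod>l\<in>{1..m}. [:-s l, 1:])" and c: "c \<noteq> 0"
    and inj: "inj_on s {1..m}"
  obtains Q where "Q \<in> qpolys_in K"
    "emb Q = c ^ ((m - 1) * (m - 2) + ((m - 1) choose 2)) *
      (\<Prod>j\<in>{1..m}. \<Prod>i\<in>{1..<j}. (poly f (s i) - poly f (s j)) / (c * (s i - s j) ^ 3))"
proof -
  define R where "R = emb ` qpolys_in K"
  have R: "rational_subalgebra R" unfolding R_def by (rule rational_subalgebra_emb_qpolys_in)
  note char = CHAR_qclosure
  define J :: "nat \<Rightarrow> nat \<Rightarrow> (nat \<Rightarrow> qclosure) \<Rightarrow> qclosure" where "J = difference_quotient (Polynomial.degree f) {1..m}"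
  define q where "q = (\<lambda>x y. (poly f x - poly f y) / (c * (x - y) ^ 3))"
  have q_sym: "q x y = q y x" for x y
    unfolding q_def by (rule cubic_quotient_commute)
  \<comment> \<open>A permuted tuple lists the roots of the same derivative, so
    \<open>diff_critical_values\<close> applies to it too. Symmetry thus comes from that of
    \<open>q\<close>, not from the formula for \<open>J\<close>.\<close>
  have J: "(\<Prod>j\<in>{1..m}. \<Prod>i\<in>{1..<j}. J i j (s \<circ> \<sigma>)) = (\<Prod>j\<in>{1..m}. \<Prod>i\<in>{1..<j}. q (s i) (s j))"
    if \<sigma>: "\<sigma> permutes {1..m}" for \<sigma>
  proof -
    have f'\<sigma>: "pderiv f = Polynomial.smult c (\<Prod>l\<in>{1..m}. [:-(s \<circ> \<sigma>) l, 1:])"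
      using prod.permute[OF \<sigma>, of "\<lambda>l. [:-s l, 1:]"] f' by (simp add: o_def)
    have "(\<Prod>j\<in>{1..m}. \<Prod>i\<in>{1..<j}. J i j (s \<circ> \<sigma>)) =
        (\<Prod>j\<in>{1..m}. \<Prod>i\<in>{1..<j}. q (s (\<sigma> i)) (s (\<sigma> j)))"
    proof (intro prod.cong refl)
      fix j i assume ij: "j \<in> {1..m}" "i \<in> {1..<j}"
      then have i: "i \<in> {1..m}" "i \<noteq> j" by auto
      note eq = diff_critical_values[OF char f'\<sigma> _ i(1) ij(1) i(2) order_refl]
      have "\<sigma> i \<in> {1..m}" "\<sigma> j \<in> {1..m}" "\<sigma> i \<noteq> \<sigma> j"
        using i ij(1) permutes_in_image[OF \<sigma>] permutes_inj[OF \<sigma>]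
        by (auto dest: injD)
      then have "s (\<sigma> i) \<noteq> s (\<sigma> j)" using inj by (auto dest: inj_onD)
      then show "J i j (s \<circ> \<sigma>) = q (s (\<sigma> i)) (s (\<sigma> j))"
        using eq c by (simp add: J_def q_def o_def field_simps)
    qed
    also have "\<dots> = (\<Prod>j\<in>{1..m}. \<Prod>i\<in>{1..<j}. q (s i) (s j))"
      by (rule prod_pairs_permute[OF \<sigma>, of "\<lambda>i j. q (s i) (s j)"]) (rule q_sym)
    finally show ?thesis .
  qed
  have "c ^ ((m - 1) * (m - 2) + ((m - 1) choose 2) * 1) * (\<Prod>j\<in>{1..m}. \<Prod>i\<in>{1..<j}. J i j s) \<in> R"
  proof (rule prod_pairs_in_subalgebra[OF R])
    fix k assume "k \<le> m"
    then show "c * esym {1..m} s k \<in> R"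
      using coeffs by (intro esym_in_subalgebra[OF R]) (auto simp: f' R_def)
  next
    fix i j assume "i \<in> {1..m}" "j \<in> {1..m}" "i \<noteq> j"
    from bounded_degree_difference_quotient[OF char R _ this]
    show "bounded_degree R {1..m} (\<lambda>k. if k = i \<or> k = j then m - 2 else 1) (J i j)"
      unfolding J_def card_atLeastAtMost diff_Suc_1 by simp
  next
    fix \<sigma> assume "\<sigma> permutes {1..m}"
    then show "(\<Prod>j\<in>{1..m}. \<Prod>i\<in>{1..<j}. J i j (s \<circ> \<sigma>)) = (\<Prod>j\<in>{1..m}. \<Prod>i\<in>{1..<j}. J i j s)"
      using J[of \<sigma>] J[OF permutes_id] by simp
  qed
  also have "(\<Prod>j\<in>{1..m}. \<Prod>i\<in>{1..<j}. J i j s) = (\<Prod>j\<in>{1..m}. \<Prod>i\<in>{1..<j}. q (s i) (s j))"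
    using J[OF permutes_id] by simp
  finally show thesis using that by (auto simp: q_def R_def)
qed

text \<open>A squared difference has degree 2 in its own two variables and 0 in the others, so a
  product over pairs has degree \<open>2 * (m - 1)\<close> in each root.\<close>

lemma prod_square_differences_polynomial:
  fixes s :: "nat \<Rightarrow> qclosure"
  assumes "\<And>k. poly.coeff (Polynomial.smult c (\<Prod>l\<in>{1..m}. [:-s l, 1:])) k \<in> emb ` qpolys_in K"
  obtains A where "A \<in> qpolys_in K"
    "emb A = c ^ (2 * m - 2) * (\<Prod>j\<in>{1..m}. \<Prod>i\<in>{1..<j}. (s i - s j)\<^sup>2)"
proof -
  define R where "R = emb ` qpolys_in K"
  have R: "rational_subalgebra R" unfolding R_def by (rule rational_subalgebra_emb_qpolys_in)
  have coeffs: "poly.coeff (Polynomial.smult c (\<Prod>l\<in>{1..m}. [:-s l, 1:])) k \<in> R" for k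
    unfolding R_def by (rule assms)
  have "c ^ ((m - 1) * 2 + ((m - 1) choose 2) * 0) *
      (\<Prod>j\<in>{1..m}. \<Prod>i\<in>{1..<j}. (\<lambda>x. (x i - x j)\<^sup>2) s) \<in> R"
  proof (rule prod_pairs_in_subalgebra[OF R])
    fix k assume "k \<le> m"
    then show "c * esym {1..m} s k \<in> R"
      using coeffs by (intro esym_in_subalgebra[OF R]) auto
  next
    fix i j assume ij: "i \<in> {1..m}" "j \<in> {1..m}" "i \<noteq> j"
    have var: "bounded_degree R {1..m} (\<lambda>k. if k = i \<or> k = j then 1 else 0) (\<lambda>x. x l)"
      if "l \<in> {i, j}" for l
      by (rule bounded_degree_mono[OF bounded_degree_var[OF R]]) (use ij that in auto)
    have "bounded_degree R {1..m} (\<lambda>k. 2 * (if k = i \<or> k = j then 1 else 0)) (\<lambda>x. (x i - x j)\<^sup>2)"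
      by (intro bounded_degree_power[OF R] bounded_degree_diff[OF R] var) auto
    then show "bounded_degree R {1..m} (\<lambda>k. if k = i \<or> k = j then 2 else 0) (\<lambda>x. (x i - x j)\<^sup>2)"
      by (rule bounded_degree_mono) auto
  next
    fix \<sigma> assume "\<sigma> permutes {1..m}"
    from prod_pairs_permute[OF this, of "\<lambda>i j. (s i - s j)\<^sup>2"]
    show "(\<Prod>j\<in>{1..m}. \<Prod>i\<in>{1..<j}. ((s \<circ> \<sigma>) i - (s \<circ> \<sigma>) j)\<^sup>2) =
        (\<Prod>j\<in>{1..m}. \<Prod>i\<in>{1..<j}. (s i - s j)\<^sup>2)"
      by (simp add: power2_commute)
  qed
  then show thesis using that by (auto simp: R_def diff_mult_distrib2 mult.commute)
qed

subsection \<open>The factorization\<close>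

text \<open>Numerator and denominator of each factor both change sign when \<open>i\<close> and
  \<open>j\<close> are swapped, so one enumeration of the roots serves for all.\<close>

lemma B0_permute:
  assumes "\<sigma> permutes {1..n-1}" "\<And>i. i \<in> {1..n-1} \<Longrightarrow> s i = s' (\<sigma> i)"
  shows "B0 n s = B0 n s'"
proof -
  define q where "q = (\<lambda>x y. (poly (gen_poly n) x - poly (gen_poly n) y) / (x - y) ^ 3)"
  have q_sym: "q x y = q y x" for x y
    unfolding q_def using cubic_quotient_commute[of _ _ 1] by simp
  have "(\<Prod>j\<in>{1..n-1}. \<Prod>i\<in>{1..<j}. q (s i) (s j)) =
      (\<Prod>j\<in>{1..n-1}. \<Prod>i\<in>{1..<j}. q (s' (\<sigma> i)) (s' (\<sigma> j)))"
    by (intro prod.cong refl) (auto simp: assms(2))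
  also have "\<dots> = (\<Prod>j\<in>{1..n-1}. \<Prod>i\<in>{1..<j}. q (s' i) (s' j))"
    by (rule prod_pairs_permute[OF assms(1), of "\<lambda>i j. q (s' i) (s' j)"]) (rule q_sym)
  finally show ?thesis by (simp add: B0_def q_def)
qed

text \<open>With \<open>p = n - 2\<close>, this matches the exponents of both \<open>n\<close> and
  the leading coefficient in the final comparison.\<close>

lemma power_int_exponent_sum:
  fixes x :: "'a::field"
  assumes "x \<noteq> 0"
  shows "x powi (2 * (int p * (int p - 2))) * x ^ (6 * p) = x ^ (2 * p * (p + 1))"
proof -
  have "x powi (2 * (int p * (int p - 2))) * x ^ (6 * p) =
      x powi (2 * (int p * (int p - 2)) + int (6 * p))"
    using assms by (subst power_int_add) (auto simp only: power_int_of_nat)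
  also have "2 * (int p * (int p - 2)) + int (6 * p) = int (2 * p * (p + 1))"
    by (simp add: algebra_simps)
  finally show ?thesis by (simp only: power_int_of_nat)
qed

theorem theorem4p4:
  fixes n :: nat
  assumes "n \<ge> 2"
  shows "\<exists>(C :: rat) (D :: qpoly poly) (DD :: qpoly) (A :: qpoly) (B :: qpoly).
           C \<noteq> 0 \<and>
           is_disc_in_a0 n D \<and>
           DD \<in> qpolys_in {1..n} \<and> emb DD = disc (map_poly emb D) \<and>
           A \<in> qpolys_in {1..n} \<and> emb A = A0 n \<and>
           B \<in> qpolys_in {1..n} \<and>
           (\<forall>s. enumerates_roots s (pderiv (gen_poly n)) \<longrightarrow> emb B = B0 n s) \<and>
           DD = qconst C * A ^ 3 * B ^ 2"
proof -

  \<comment> \<open>The derivative of the generic polynomial and its roots\<close>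
  define p where "p = n - 2"
  define m where "m = n - 1"
  have nmp: "n = Suc (Suc p)" "n = Suc m" "m = Suc p" using assms by (auto simp: p_def m_def)
  have exponent: "2 * m - 2 = 2 * p" by (simp add: nmp(3))
  define R where "R = emb ` qpolys_in {1..n}"
  have R: "rational_subalgebra R" unfolding R_def by (rule rational_subalgebra_emb_qpolys_in)
  define f where "f = gen_poly n"
  define a where "a = emb (indet n)"
  define a0 where "a0 = emb (indet 0)"
  define N where "N = (of_nat n :: qclosure)"
  define c where "c = N * a"
  have N: "N \<noteq> 0" using assms CHAR_qclosure by (simp add: N_def of_nat_eq_0_iff_char_dvd)
  have NR: "N \<in> R" unfolding N_def by (rule subalgebra_of_nat[OF R])
  have invNR: "inverse N \<in> R"
    using subalgebra_of_nat_mult_cancel[OF R, of n "inverse N"] subalgebra_1[OF R] N assms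
    by (simp add: N_def)
  have a: "a \<noteq> 0" by (simp add: a_def emb_indet_nonzero)
  have c: "c \<noteq> 0" using N a by (simp add: c_def)
  have degf: "Polynomial.degree f = n" by (simp add: f_def degree_gen_poly)
  have lcf: "Polynomial.lead_coeff f = a" by (simp add: f_def degree_gen_poly coeff_gen_poly a_def)
  have coeff_f: "poly.coeff f (Suc k) \<in> R" for k
    unfolding f_def coeff_gen_poly
    using indet_in_qpolys_in[of "Suc k" "{1..n}"] subalgebra_0[OF R] by (auto simp: R_def)
  have degf': "Polynomial.degree (pderiv f) = m" by (simp only: degree_pderiv_CHAR_0[OF CHAR_qclosure] degf m_def)
  have lcf': "Polynomial.lead_coeff (pderiv f) = c"
    unfolding degf' using lcf degf by (simp add: coeff_pderiv nmp(2) c_def N_def)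
  have f'0: "pderiv f \<noteq> 0" using lcf' c by auto
  have coeff_f': "poly.coeff (pderiv f) k \<in> R" for k
    unfolding coeff_pderiv by (intro subalgebra_mult[OF R] subalgebra_of_nat[OF R] coeff_f)
  obtain s where s: "enumerates_roots s (pderiv f)" using enumerates_roots_exists[OF f'0] by blast
  have f': "pderiv f = Polynomial.smult c (\<Prod>j\<in>{1..m}. [:-s j, 1:])"
    using enumerates_roots_imp_prod[OF f'0 s] degf' lcf' by simp
  have esym: "c * esym {1..m} s k \<in> R" if "k \<le> m" for k
    using that coeff_f' by (intro esym_in_subalgebra[OF R]) (auto simp: f')
  have root: "poly (pderiv f) (s j) = 0" if "j \<in> {1..m}" for j
    using that by (auto simp: f' poly_prod intro!: prod_zero)

  \<comment> \<open>Splitting off the constant term\<close>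
  define \<phi> where "\<phi> = f - [:a0:] - Polynomial.smult (1 / N) (pCons 0 (pderiv f))"
  have coeff_\<phi>: "poly.coeff \<phi> k = (if k = 0 then 0 else (1 - of_nat k * inverse N) * poly.coeff f k)" for k
    by (cases k) (simp_all add: \<phi>_def f_def coeff_gen_poly a0_def coeff_pderiv divide_inverse algebra_simps)
  have \<phi>R: "poly.coeff \<phi> k \<in> R" for k
    unfolding coeff_\<phi> using coeff_f[of "k - 1"]
    by (auto intro!: subalgebra_0[OF R] subalgebra_mult[OF R] subalgebra_diff[OF R]
        subalgebra_1[OF R] subalgebra_of_nat[OF R] invNR)
  \<comment> \<open>The factor \<open>1 - k / n\<close> vanishes at \<open>k = n\<close>. Without
    this drop in degree, the power \<open>c ^ m\<close> in the discriminant would not cover the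
    degree in each root.\<close>
  have deg\<phi>: "Polynomial.degree \<phi> \<le> m"
  proof (rule degree_le, intro allI impI)
    fix i assume "m < i"
    then consider "i = n" | "i > n" using nmp by linarith
    then show "poly.coeff \<phi> i = 0"
      by cases (use N in \<open>auto simp: coeff_\<phi> f_def coeff_gen_poly N_def\<close>)
  qed
  have f_s: "poly f (s j) = poly \<phi> (s j) + a0" if "j \<in> {1..m}" for j
    using root[OF that] by (simp add: \<phi>_def)

  \<comment> \<open>The discriminant as a polynomial in the constant term\<close>
  have "n \<ge> 1" using assms by simp
  from disc_eq_prod_critical_values[OF CHAR_qclosure degf this s]
  obtain k where "disc f = (-1) ^ k * N * c ^ m * (\<Prod>j\<in>{1..m}. poly f (s j))"
    unfolding lcf N_def[symmetric] c_def[symmetric] m_def[symmetric] .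
  note disc_f = this
  define \<epsilon> where "\<epsilon> = ((-1) ^ k :: qclosure)"
  \<comment> \<open>The variable of \<open>P\<close> takes the place of \<open>a0\<close> in the
    product of the values \<open>poly \<phi> (s j) + a0\<close>.\<close>
  define P where "P = Polynomial.smult (\<epsilon> * N * c ^ m) (\<Prod>j\<in>{1..m}. [:poly \<phi> (s j), 1:])"
  have \<epsilon>R: "\<epsilon> \<in> R"
    unfolding \<epsilon>_def by (intro subalgebra_power[OF R] subalgebra_uminus[OF R] subalgebra_1[OF R])
  have "poly.coeff P k \<in> R" for k
  proof -
    have "c ^ m * poly.coeff (\<Prod>j\<in>{1..m}. [:poly \<phi> (s j), 1:]) k \<in> R"
      by (rule coeff_prod_linear_in_subalgebra[OF R]) (use esym \<phi>R deg\<phi> in auto)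
    then have "\<epsilon> * N * (c ^ m * poly.coeff (\<Prod>j\<in>{1..m}. [:poly \<phi> (s j), 1:]) k) \<in> R"
      unfolding N_def
      by (rule subalgebra_mult[OF R subalgebra_mult[OF R \<epsilon>R subalgebra_of_nat[OF R]]])
    then show ?thesis by (simp add: P_def mult.assoc)
  qed
  then obtain D where D: "\<And>k. poly.coeff D k \<in> qpolys_in {1..n}" "map_poly emb D = P"
    using poly_emb_preimage[of P "{1..n}"] by (auto simp: R_def)
  have "emb (poly D (indet 0)) = poly P a0"
    by (simp add: a0_def flip: D(2) poly_map_poly_emb)
  also have "\<dots> = \<epsilon> * N * c ^ m * (\<Prod>j\<in>{1..m}. poly f (s j))"
    by (simp add: P_def poly_prod f_s)
  also have "\<dots> = disc f"
    by (simp add: disc_f \<epsilon>_def)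
  finally have is_disc: "is_disc_in_a0 n D"
    using D(1) by (simp add: is_disc_in_a0_def f_def)

  \<comment> \<open>The iterated discriminant in terms of the critical values\<close>
  have pairs_zero: "(\<Prod>j\<in>{1..m}. \<Prod>i\<in>{1..<j}. g i j) = 0"
    if "j \<in> {1..m}" "i \<in> {1..<j}" "g i j = 0" for g :: "nat \<Rightarrow> nat \<Rightarrow> qclosure" and i j
    by (simp only: prod_zero_iff finite_atLeastAtMost finite_atLeastLessThan) (use that in blast)
  define V where "V = (\<Prod>j\<in>{1..m}. \<Prod>i\<in>{1..<j}. s i - s j)"
  define W where "W = (\<Prod>j\<in>{1..m}. \<Prod>i\<in>{1..<j}. poly f (s i) - poly f (s j))"
  have \<epsilon>: "\<epsilon> ^ (2 * k) = 1" for k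
    unfolding \<epsilon>_def power_mult[symmetric] by (subst mult.left_commute) simp
  have degP: "Polynomial.degree P = m"
    using c N by (simp add: P_def \<epsilon>_def degree_prod_eq_sum_degree)
  have lcP: "Polynomial.lead_coeff P = \<epsilon> * N * c ^ m"
    by (simp only: P_def lead_coeff_smult lead_coeff_prod) simp
  have "enumerates_roots (\<lambda>j. - poly \<phi> (s j)) P"
    using enumerates_roots_prod[of "\<epsilon> * N * c ^ m" "\<lambda>j. - poly \<phi> (s j)" m] c N
    by (simp add: P_def \<epsilon>_def)
  from disc_eq[OF this] have "disc P = (\<epsilon> * N * c ^ m) ^ (2 * p) *
      (\<Prod>j\<in>{1..m}. \<Prod>i\<in>{1..<j}. (- poly \<phi> (s i) - - poly \<phi> (s j))\<^sup>2)"
    unfolding degP lcP[unfolded degP] exponent .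
  also have "(\<Prod>j\<in>{1..m}. \<Prod>i\<in>{1..<j}. (- poly \<phi> (s i) - - poly \<phi> (s j))\<^sup>2) =
      (\<Prod>j\<in>{1..m}. \<Prod>i\<in>{1..<j}. (poly f (s i) - poly f (s j))\<^sup>2)"
    by (intro prod.cong refl) (auto simp: f_s power2_commute)
  also have "\<dots> = W\<^sup>2" by (simp add: W_def prod_power_distrib)
  finally have discP: "disc P = (N * c ^ m) ^ (2 * p) * W\<^sup>2"
    by (simp add: power_mult_distrib \<epsilon>)

  \<comment> \<open>Polynomiality of the discriminant of the derivative\<close>
  have A0: "A0 n = c ^ (2 * p) * V\<^sup>2"
    using disc_eq[OF s] unfolding degf' lcf'[unfolded degf'] exponent
    by (simp add: A0_def V_def prod_power_distrib flip: f_def)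
  obtain A where "A \<in> qpolys_in {1..n}"
    "emb A = c ^ (2 * m - 2) * (\<Prod>j\<in>{1..m}. \<Prod>i\<in>{1..<j}. (s i - s j)\<^sup>2)"
    by (rule prod_square_differences_polynomial[OF coeff_f'[unfolded f' R_def]])
  then have A: "A \<in> qpolys_in {1..n}" "emb A = A0 n"
    unfolding exponent by (simp_all add: A0 V_def prod_power_distrib)

  \<comment> \<open>Polynomiality of the second factor\<close>
  define e where "e = int p * (int p - 2)"
  have ne: "(int n - 2) * (int n - 4) = e" by (simp add: e_def nmp(1))
  have B0: "B0 n s = N ^ p * a powi e * (W / V ^ 3)"
    unfolding B0_def W_def V_def f_def[symmetric] N_def[symmetric] a_def[symmetric]
      p_def[symmetric] m_def[symmetric] ne
    by (simp only: prod_power_distrib prod_dividef)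
  have "B0 n s \<in> R"
  \<comment> \<open>\<open>f'\<close> is in fact separable; this need not be shown, since \<open>B\<close> and \<open>DD\<close> vanish with \<open>V\<close> because
     of \<open>x / 0 = 0\<close>.\<close>
  proof (cases "V = 0")
    case True
    then show ?thesis by (simp add: B0 subalgebra_0[OF R])
  next
    case False
    have "s i \<noteq> s j" if "i \<in> {1..m}" "j \<in> {1..m}" "i < j" for i j
    proof
      assume "s i = s j"
      then have "V = 0" unfolding V_def using that by (intro pairs_zero[of j i]) auto
      with False show False by simp
    qed
    then have inj: "inj_on s {1..m}" by (intro linorder_inj_onI) auto
    define d where "d = p * (p - 1) + (p choose 2)"
    define Q where "Q = (\<Prod>j\<in>{1..m}. \<Prod>i\<in>{1..<j}. (poly f (s i) - poly f (s j)) / (c * (s i - s j) ^ 3))"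
    have mp: "(m - 1) * (m - 2) + ((m - 1) choose 2) = d" by (simp add: d_def nmp(3))
    obtain Q' where Q': "Q' \<in> qpolys_in {1..n}" "emb Q' = c ^ d * Q"
      by (rule prod_critical_difference_quotients_polynomial[OF coeff_f'[unfolded R_def] f' c inj,
            folded Q_def, unfolded mp])
    then have "c ^ d * Q \<in> R" by (auto simp: R_def simp flip: Q'(2))
    \<comment> \<open>As \<open>c = N * a\<close>, the power of \<open>a\<close> becomes one of
      \<open>c\<close> up to a power of \<open>N\<close>, which is a unit of \<open>R\<close>. Each
      pair supplies a further \<open>c\<close> from the denominators in \<open>Q\<close>, and
      \<open>e + (m choose 2)\<close> is exactly the degree \<open>d\<close>.\<close>
    moreover have "B0 n s = (N ^ p * N powi (-e)) * (c ^ d * Q)"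
    proof -
      have "Q = (W / V ^ 3) / c ^ (m choose 2)"
        unfolding Q_def W_def V_def
        by (simp only: prod_dividef prod.distrib prod_pairs_const prod_power_distrib) simp
      then have "W / V ^ 3 = c ^ (m choose 2) * Q" using c by simp
      moreover have "a powi e = N powi (-e) * c powi e"
        using N by (simp add: c_def power_int_mult_distrib power_int_minus)
      moreover have "c powi e * c ^ (m choose 2) = c ^ d"
      proof -
        have "c powi e * c ^ (m choose 2) = c powi (e + int (m choose 2))"
          using c by (subst power_int_add) (auto simp only: power_int_of_nat)
        also have "e + int (m choose 2) = int d"
          by (cases p) (simp_all add: e_def d_def nmp(3) numeral_2_eq_2 algebra_simps)
        finally show ?thesis by simp
      qed
      ultimately show ?thesis
        by (simp add: B0 mult_ac)
    qed
    moreover have "N ^ p * N powi (-e) \<in> R"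
      unfolding power_int_def
      by (intro subalgebra_mult[OF R] subalgebra_power[OF R] NR) (auto intro: subalgebra_power[OF R] NR invNR)
    ultimately show ?thesis by (simp only: subalgebra_mult[OF R])
  qed
  then obtain B where B: "B \<in> qpolys_in {1..n}" "emb B = B0 n s" by (auto simp: R_def)
  have B_all: "emb B = B0 n s'" if s': "enumerates_roots s' (pderiv (gen_poly n))" for s'
  proof -
    obtain \<sigma> where "\<sigma> permutes {1..m}" "\<And>i. i \<in> {1..m} \<Longrightarrow> s i = s' (\<sigma> i)"
      using enumerates_roots_permutes[OF s s'[folded f_def]] unfolding degf' by blast
    then show ?thesis using B0_permute[of \<sigma> n s s'] B(2) by (simp add: m_def)
  qed

  \<comment> \<open>The constant and the comparison of powers\<close>
  define C where "C = (of_nat n powi (2 * e) :: rat)"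
  have "C \<noteq> 0" using assms by (simp add: C_def)
  define DD where "DD = qconst C * A ^ 3 * B ^ 2"
  have "DD \<in> qpolys_in {1..n}"
    using A(1) B(1) by (simp add: DD_def qpolys_in_mult qconst_in_qpolys_in power2_eq_square power3_eq_cube)
  have "emb DD = N powi (2 * e) * (c ^ (2 * p) * V\<^sup>2) ^ 3 * (N ^ p * a powi e * (W / V ^ 3)) ^ 2"
    by (simp add: DD_def A B B0 A0 C_def emb_qconst_power_int qconst_of_nat N_def)
  also have "\<dots> = (N * c ^ m) ^ (2 * p) * W\<^sup>2"
  proof (cases "V = 0")
    case True
    then obtain j i where "j \<in> {1..m}" "i \<in> {1..<j}" "s i = s j"
      unfolding V_def by (auto simp: prod_zero_iff)
    then have "W = 0" unfolding W_def by (intro pairs_zero[of j i]) auto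
    with True show ?thesis by simp
  next
    case False
    \<comment> \<open>Apart from \<open>a\<close>, \<open>V\<close> and \<open>W\<close>, the third
      power of \<open>A\<close> and the square of \<open>B\<close> contribute \<open>N\<close> to
      the exponent \<open>8 * p\<close>, whereas the iterated discriminant has
      \<open>2 * p * (p + 2)\<close>. The difference is \<open>2 * e\<close>, which explains
      \<open>C\<close>.\<close>
    have "N powi (2 * e) * (c ^ (2 * p) * V\<^sup>2) ^ 3 * (N ^ p * a powi e * (W / V ^ 3)) ^ 2 =
        N powi (2 * e) * c ^ (6 * p) * N ^ (2 * p) * a powi (2 * e) * W\<^sup>2"
      using False by (simp add: power_mult_distrib power_divide power_int_mult mult.commute[of 2 e]
          flip: power_mult) (simp add: mult_ac)
    also have "\<dots> = (N powi (2 * e) * N ^ (6 * p)) * (a powi (2 * e) * a ^ (6 * p)) * N ^ (2 * p) * W\<^sup>2"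
      by (simp add: c_def power_mult_distrib mult_ac)
    also have "\<dots> = (N * a) ^ (2 * p * (p + 1)) * N ^ (2 * p) * W\<^sup>2"
      unfolding e_def power_int_exponent_sum[OF N] power_int_exponent_sum[OF a] power_mult_distrib ..
    also have "\<dots> = (N * c ^ m) ^ (2 * p) * W\<^sup>2"
      by (simp add: c_def nmp(3) power_mult_distrib mult_ac flip: power_mult)
        (simp add: power_add mult_ac)
    finally show ?thesis .
  qed
  finally have "emb DD = disc (map_poly emb D)" by (simp add: D(2) discP)
  then show ?thesis
    using \<open>C \<noteq> 0\<close> is_disc \<open>DD \<in> _\<close> A B(1) B_all DD_def by blast
qed

end
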